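(* Let $\mathcal A$ be a finite-dimensional $C^*$-algebra over $\mathbb F\in\{\mathbb R,\mathbb C\}$ and let $A\in\mathcal A$. The following are equivalent: (i) $A$ is a scalar multiple (with scalar in $\mathbb F$) of some unitary $U\in\mathcal A$. (ii) There does not exist a non-zero $B\in\mathcal A$ such that $A^\bot\subsetneq B^\bot$. (iii) $A$ is right-symmetric in $\mathcal A$.
   Context: $C^*$-algebras may be real or complex; a finite-dimensional $C^*$-algebra over $\mathbb F$ is $*$-isomorphic to $\bigoplus_{k=1}^\ell\mathcal M_{n_k}(\mathbb K_k)$ with all $\mathbb K_k=\mathbb C$ if $\mathbb F=\mathbb C$ and $\mathbb K_k\in\{\mathbb R,\mathbb C,\mathbb H\}$ if $\mathbb F=\mathbb R$ (involution is conjugate transpose, norm is the maximum of the operator norms of the blocks). For $v,w$ in a normed space $V$ over $\mathbb F$, $v\perp w$ (Birkhoff–James orthogonality) means $\|v\|\le\|v+\lambda w\|$ for all $\lambda\in\mathbb F$; $v^\bot=\{w\in V: v\perp w\}$. A vector $v$ is right-symmetric if $w\perp v$ implies $v\perp w$ for all $w\in V$. *)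

theory Defs
  imports "HOL-Analysis.Analysis"
begin

text \<open>
  The scalar field is a set \<open>F\<close> of complex numbers, either \<open>\<real>\<close> or all of \<open>\<complex>\<close>, so that real and
  complex algebras are treated uniformly.  Scalar multiplication \<open>smul\<close> by \<open>c :: complex\<close> is
  only meaningful for \<open>c \<in> F\<close>: for \<open>F = \<real>\<close> it is \<^const>\<open>scaleR\<close> by \<open>smul_of_real\<close>, and its values
  at non-real scalars are unconstrained.

  The type class supplies a non-zero unital Banach algebra over the reals.  A finite-dimensional
  C*-algebra is automatically unital, so assuming a unit is no restriction.
\<close>

locale cstar_algebra =
  fixes F :: "complex set"
    and smul :: "complex \<Rightarrow> 'a \<Rightarrow> 'a::{real_normed_algebra_1, banach}"
    and star :: "'a \<Rightarrow> 'a"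
  assumes scalar_field: "F = \<real> \<or> F = UNIV"
    and smul_of_real: "smul (of_real r) x = r *\<^sub>R x"
    and smul_add_right: "c \<in> F \<Longrightarrow> smul c (x + y) = smul c x + smul c y"
    and smul_add_left: "c \<in> F \<Longrightarrow> d \<in> F \<Longrightarrow> smul (c + d) x = smul c x + smul d x"
    and smul_smul: "c \<in> F \<Longrightarrow> d \<in> F \<Longrightarrow> smul c (smul d x) = smul (c * d) x"
    and smul_mult_left: "c \<in> F \<Longrightarrow> smul c x * y = smul c (x * y)"
    and smul_mult_right: "c \<in> F \<Longrightarrow> x * smul c y = smul c (x * y)"
    and norm_smul: "c \<in> F \<Longrightarrow> norm (smul c x) = cmod c * norm x"
    and star_star: "star (star x) = x"
    and star_add: "star (x + y) = star x + star y"
    and star_smul: "c \<in> F \<Longrightarrow> star (smul c x) = smul (cnj c) (star x)"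
    and star_mult: "star (x * y) = star y * star x"
    and cstar_identity: "norm (star x * x) = (norm x)\<^sup>2"
    \<comment> \<open>Part of the usual axioms of a real C*-algebra (automatic over \<open>\<complex>\<close>).  Without it \<open>\<complex>\<close>, taken
      as a real algebra with the identity as involution, would qualify.\<close>
    and invertible_one_plus_star_mult:
      "F = \<real> \<Longrightarrow> \<exists>y. y * (1 + star x * x) = 1 \<and> (1 + star x * x) * y = 1"

locale finite_dim_cstar_algebra = cstar_algebra +
  assumes finite_dim:
    "\<exists>S. finite S \<and> (\<forall>x. \<exists>c. (\<forall>s\<in>S. c s \<in> F) \<and> x = (\<Sum>s\<in>S. smul (c s) s))"

definition unitary :: "('a \<Rightarrow> 'a) \<Rightarrow> 'a::monoid_mult \<Rightarrow> bool" where
  "unitary star u \<longleftrightarrow> star u * u = 1 \<and> u * star u = 1"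

text \<open>Birkhoff--James orthogonality over the scalars \<open>F\<close>.\<close>

definition bj_orthogonal ::
    "complex set \<Rightarrow> (complex \<Rightarrow> 'a \<Rightarrow> 'a) \<Rightarrow> 'a \<Rightarrow> 'a::real_normed_vector \<Rightarrow> bool" where
  "bj_orthogonal F smul v w \<longleftrightarrow> (\<forall>c\<in>F. norm v \<le> norm (v + smul c w))"

definition bj_perp ::
    "complex set \<Rightarrow> (complex \<Rightarrow> 'a \<Rightarrow> 'a) \<Rightarrow> 'a \<Rightarrow> 'a::real_normed_vector set" where
  "bj_perp F smul v = {w. bj_orthogonal F smul v w}"

definition right_symmetric ::
    "complex set \<Rightarrow> (complex \<Rightarrow> 'a \<Rightarrow> 'a) \<Rightarrow> 'a::real_normed_vector \<Rightarrow> bool" where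
  "right_symmetric F smul v \<longleftrightarrow>
    (\<forall>w. bj_orthogonal F smul w v \<longrightarrow> bj_orthogonal F smul v w)"

end

theory Submission
  imports Defs "HOL-Computational_Algebra.Fundamental_Theorem_Algebra"
begin

text \<open>
  Everything rests on the spectral theorem for a single self-adjoint element \<open>h\<close>, obtained by
  factoring a real polynomial that annihilates \<open>h\<close>: \<open>h\<close> is a real combination of orthogonal
  projections, and the norm of such a combination is its largest absolute coefficient.  Together
  with positivity of \<open>x\<^sup>* x\<close> and compactness of bounded sets this gives a polar decomposition
  \<open>A = U h\<close> with \<open>U\<close> unitary and \<open>h\<close> positive.  Left multiplication by a unitary is an isometry
  and so preserves orthogonality.

  Let \<open>A \<noteq> 0\<close>.  The spectrum of \<open>h\<close> lies in \<open>[0, norm h]\<close>, so \<open>U h\<close> is \<open>(norm h / 2) U\<close> plus an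
  element of norm at most \<open>norm h / 2\<close>; a direction in which the norm of \<open>U\<close> decreases therefore also
  decreases that of \<open>A\<close>, which means that \<open>A\<^sup>\<bottom>\<close> is contained in \<open>U\<^sup>\<bottom>\<close>
  (\<open>perp_subset_perp_polar_unitary\<close>).  Conversely, if \<open>V\<close> is unitary and \<open>V\<^sup>\<bottom>\<close> is contained in
  \<open>B\<^sup>\<bottom>\<close> with \<open>B \<noteq> 0\<close>, then \<open>B\<close> is a multiple of a unitary (\<open>unitary_perp_subset_imp_unitary\<close>), and
  recurrence of powers of unitaries turns the inclusion into an equality
  (\<open>unitary_perp_subset_imp_supset\<close>).  These facts show that the non-zero elements with maximal
  orthogonal set are the non-zero multiples of unitaries.

  For right symmetry, take \<open>w\<close> that a unitary is not orthogonal to; after multiplication by a unitary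
  and a scalar, \<open>norm (1 - w) < 1\<close>.  Then \<open>w\<close> has positive real part, so subtracting a small
  positive scalar reduces its norm, and \<open>w\<close> is not orthogonal to \<open>1\<close> (\<open>near_one_not_orth_one\<close>).
  If \<open>A = U h\<close> is not a multiple of a unitary, then \<open>h\<close> has at least two eigenvalues, and a
  reflection that has opposite signs on the top eigenspace and on the others violates right
  symmetry (\<open>right_symmetric_imp_unitary\<close>).
\<close>

section \<open>Finite-dimensional normed spaces\<close>

text \<open>
  By induction on \<open>S\<close>: the span of \<open>S\<close> is closed, so a new vector \<open>a\<close> outside it has positive
  distance \<open>d\<close> from it.  Hence the \<open>a\<close>-coordinate of a vector is at most \<open>1 / d\<close> times its norm, and
  both components of a bounded sequence are bounded.
\<close>
lemma bounded_sequence_in_finite_span: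
  fixes x :: "nat \<Rightarrow> 'a::real_normed_vector"
  assumes "finite S" and "\<And>n. x n \<in> span S" and "bounded (range x)"
  shows "\<exists>l\<in>span S. \<exists>r. strict_mono r \<and> (x \<circ> r) \<longlonglongrightarrow> l"
  using assms
proof (induction S arbitrary: x rule: finite_induct)
  case empty
  then have "x = (\<lambda>n. 0)" by auto
  then show ?case
    by (intro bexI[of _ 0] exI[of _ id]) (auto simp: strict_mono_def comp_def)
next
  case (insert a S)
  show ?case
  proof (cases "a \<in> span S")
    case True
    then show ?thesis using insert.IH[of x] insert.prems by (simp add: span_redundant)
  next
    case False
    have "closed (span S)"
      unfolding closed_sequential_limits
    proof (intro allI impI)
      fix y l assume y: "(\<forall>n. y n \<in> span S) \<and> y \<longlonglongrightarrow> l"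
      then have "bounded (range y)" using convergent_imp_bounded by blast
      then obtain l' r where l': "l' \<in> span S" "strict_mono r" "(y \<circ> r) \<longlonglongrightarrow> l'"
        using insert.IH[of y] y by blast
      then have "l = l'" using y LIMSEQ_subseq_LIMSEQ LIMSEQ_unique by blast
      then show "l \<in> span S" using l' by simp
    qed
    then obtain d where d: "d > 0" "\<And>z. z \<in> span S \<Longrightarrow> d \<le> dist z a"
      using False by (metis closed_approachable not_le)
    have "\<forall>n. \<exists>k. x n - k *\<^sub>R a \<in> span S"
      using insert.prems(1) by (simp add: span_breakdown_eq)
    then obtain c where c: "\<And>n. x n - c n *\<^sub>R a \<in> span S" by metis
    obtain M where M: "\<And>n. norm (x n) \<le> M" using insert.prems(2) by (auto simp: bounded_iff)
    have cM: "\<bar>c n\<bar> \<le> M / d" for n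
    proof (cases "c n = 0")
      case True
      have "0 \<le> M" using M[of n] norm_ge_zero order_trans by blast
      then show ?thesis using True d by simp
    next
      case False
      let ?z = "(- 1 / c n) *\<^sub>R (x n - c n *\<^sub>R a)"
      have "d \<le> dist ?z a" using d(2) span_scale[OF c] by blast
      also have "\<dots> = norm ((- 1 / c n) *\<^sub>R x n)"
        using False by (simp add: dist_norm algebra_simps)
      also have "\<dots> = norm (x n) / \<bar>c n\<bar>" by simp
      also have "\<dots> \<le> M / \<bar>c n\<bar>" using M by (simp add: divide_right_mono)
      finally show ?thesis using False d by (simp add: field_simps)
    qed
    then have "bounded (range c)" by (auto simp: bounded_iff)
    then obtain k r where k: "strict_mono r" "(c \<circ> r) \<longlonglongrightarrow> k"
      using bounded_imp_convergent_subsequence by blast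
    let ?y = "\<lambda>n. x (r n) - c (r n) *\<^sub>R a"
    have "norm (?y n) \<le> M + M / d * norm a" for n
    proof -
      have "norm (?y n) \<le> norm (x (r n)) + \<bar>c (r n)\<bar> * norm a"
        using norm_triangle_ineq4[of "x (r n)" "c (r n) *\<^sub>R a"] by simp
      also have "\<dots> \<le> M + M / d * norm a"
        by (intro add_mono M mult_right_mono cM) simp
      finally show ?thesis .
    qed
    then have "bounded (range ?y)" by (auto simp: bounded_iff)
    then obtain l s where l: "l \<in> span S" "strict_mono s" "(?y \<circ> s) \<longlonglongrightarrow> l"
      using insert.IH[of ?y] c by blast
    have "(\<lambda>n. (?y \<circ> s) n + (c \<circ> r \<circ> s) n *\<^sub>R a) \<longlonglongrightarrow> l + k *\<^sub>R a"
      by (intro tendsto_intros l LIMSEQ_subseq_LIMSEQ k)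
    then have "(x \<circ> (r \<circ> s)) \<longlonglongrightarrow> l + k *\<^sub>R a" by (simp add: comp_def)
    moreover have "l + k *\<^sub>R a \<in> span (insert a S)"
      using l(1) by (metis insertCI span_add span_base span_mono span_scale subset_eq subset_insertI)
    ultimately show ?thesis using strict_mono_o[OF k(1) l(2)] by blast
  qed
qed

section \<open>Evaluating real polynomials in an algebra\<close>

text \<open>
  Unlike in \<^const>\<open>poly\<close>, the argument lives in a possibly non-commutative algebra over the
  coefficients; the values of all polynomials at one fixed element still commute with each other.
\<close>
definition peval :: "real poly \<Rightarrow> 'a::real_algebra_1 \<Rightarrow> 'a" where
  "peval p a = fold_coeffs (\<lambda>c r. of_real c + a * r) p 0"

lemma peval_0 [simp]: "peval 0 a = 0"
  by (simp add: peval_def)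

lemma peval_pCons [simp]: "peval (pCons c p) a = of_real c + a * peval p a"
  by (cases "p = 0 \<and> c = 0") (auto simp: peval_def)

lemma peval_1 [simp]: "peval 1 a = 1"
  by (simp add: one_pCons)

lemma peval_add: "peval (p + q) a = peval p a + peval q a"
  by (induction p q rule: poly_induct2) (simp_all add: algebra_simps)

lemma peval_smult: "peval (smult c p) a = c *\<^sub>R peval p a"
  by (induction p) (simp_all add: of_real_def algebra_simps)

lemma peval_minus: "peval (- p) a = - peval p a"
  using peval_smult[of "-1" p a] by simp

lemma peval_diff: "peval (p - q) a = peval p a - peval q a"
  using peval_add[of p "- q" a] by (simp add: peval_minus)

lemma peval_mult: "peval (p * q) a = peval p a * peval q a"
  by (induction p) (simp_all add: peval_add peval_smult of_real_def algebra_simps)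

lemma peval_sum: "peval (\<Sum>i\<in>I. p i) a = (\<Sum>i\<in>I. peval (p i) a)"
  by (induction I rule: infinite_finite_induct) (simp_all add: peval_add)

lemma peval_power: "peval (p ^ n) a = peval p a ^ n"
  by (induction n) (simp_all add: peval_mult)

lemma peval_monom: "peval (monom c n) a = c *\<^sub>R a ^ n"
  by (simp add: monom_altdef peval_smult peval_power)

lemma peval_commute: "peval p a * peval q a = peval q a * peval p a"
  by (metis peval_mult mult.commute)

text \<open>The powers of \<open>a\<close> up to the size of a spanning set are linearly dependent or repeat.\<close>
lemma ex_annihilating_poly:
  fixes a :: "'a::real_algebra_1"
  assumes "finite S" "span S = (UNIV :: 'a set)"
  shows "\<exists>m. m \<noteq> 0 \<and> peval m a = 0"
proof (cases "inj_on (\<lambda>i. a ^ i) {..card S}")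
  case True
  let ?P = "(\<lambda>i. a ^ i) ` {..card S}"
  have "card ?P = Suc (card S)" using True by (simp add: card_image)
  then have "dependent ?P"
    using real_vector.independent_span_bound[OF assms(1), of ?P] assms(2) by auto
  then obtain u where u: "(\<Sum>v\<in>?P. u v *\<^sub>R v) = 0" "\<exists>v\<in>?P. u v \<noteq> 0"
    by (auto simp: real_vector.dependent_finite)
  let ?m = "\<Sum>i\<le>card S. monom (u (a ^ i)) i"
  have "peval ?m a = (\<Sum>i\<le>card S. u (a ^ i) *\<^sub>R a ^ i)"
    by (simp add: peval_sum peval_monom)
  also have "\<dots> = 0" using u(1) by (simp add: sum.reindex[OF True])
  finally have "peval ?m a = 0" .
  obtain j where j: "j \<le> card S" "u (a ^ j) \<noteq> 0" using u(2) by auto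
  then have "coeff ?m j = u (a ^ j)" by (simp add: coeff_sum)
  then have "?m \<noteq> 0" using j by auto
  with \<open>peval ?m a = 0\<close> show ?thesis by blast
next
  case False
  then obtain i j where ij: "i \<noteq> j" "a ^ i = a ^ j" by (auto simp: inj_on_def)
  let ?m = "monom 1 i - monom 1 j :: real poly"
  have "peval ?m a = 0" using ij by (simp add: peval_monom peval_diff)
  moreover have "coeff ?m i \<noteq> 0" using ij by simp
  then have "?m \<noteq> 0" by force
  ultimately show ?thesis by blast
qed

text \<open>
  The left inverse allows cancelling powers of \<open>X\<close> from an annihilating polynomial of \<open>b\<close>.  What
  remains has non-zero constant term, which exhibits a right inverse of \<open>b\<close>.
\<close>
lemma left_inverse_imp_right_inverse:
  fixes a b :: "'a::real_algebra_1"
  assumes "m \<noteq> 0" "peval m b = 0" "a * b = 1"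
  shows "b * a = 1"
  using assms
proof (induction m)
  case 0
  then show ?case by simp
next
  case (pCons c q)
  show ?case
  proof (cases "c = 0")
    case True
    then have "a * (b * peval q b) = 0" using pCons.prems by simp
    then have "peval q b = 0" using pCons.prems(3) by (simp add: mult.assoc[symmetric])
    moreover have "q \<noteq> 0" using pCons.prems(1) True by simp
    ultimately show ?thesis using pCons.IH pCons.prems by simp
  next
    case False
    let ?y = "(- 1 / c) *\<^sub>R peval q b"
    have "b * peval q b = - of_real c" using pCons.prems(2) by (simp add: add_eq_0_iff2)
    then have by1: "b * ?y = 1" using False by (simp add: of_real_def)
    have "a = a * (b * ?y)" using by1 by simp
    also have "\<dots> = ?y" using pCons.prems(3) by (simp add: mult.assoc[symmetric])
    finally show ?thesis using by1 by simp
  qed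
qed

text \<open>
  The polynomial \<open>m - m(r)\<close> has the factor \<open>X - r\<close>, and its value at \<open>a\<close> is the non-zero scalar
  \<open>- m(r)\<close>.
\<close>
lemma non_root_imp_left_invertible:
  fixes a :: "'a::real_algebra_1"
  assumes "peval m a = 0" "poly m r \<noteq> 0"
  shows "\<exists>y. y * (a - of_real r) = 1"
proof -
  have "poly (m - [:poly m r:]) r = 0" by simp
  then obtain q where q: "m - [:poly m r:] = [:- r, 1:] * q"
    by (metis dvdE poly_eq_0_iff_dvd)
  have "- of_real (poly m r) = peval (q * [:- r, 1:]) a"
    using q assms(1) by (metis peval_diff mult.commute peval_pCons peval_0 mult_zero_right add_0_right diff_0)
  moreover have "peval [:- r, 1:] a = a - of_real r" by simp
  ultimately have "peval q a * (a - of_real r) = - of_real (poly m r)"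
    by (simp only: peval_mult)
  then have "((- 1 / poly m r) *\<^sub>R peval q a) * (a - of_real r) = 1"
    using assms(2) by (simp add: of_real_def)
  then show ?thesis by blast
qed

section \<open>Real polynomials\<close>

lemma prod_linear_dvd:
  fixes p :: "'a::field poly"
  assumes "finite \<Lambda>" "\<And>l. l \<in> \<Lambda> \<Longrightarrow> poly p l = 0"
  shows "(\<Prod>l\<in>\<Lambda>. [:- l, 1:]) dvd p"
  using assms
proof (induction \<Lambda> arbitrary: p rule: finite_induct)
  case empty
  then show ?case by simp
next
  case (insert l \<Lambda>)
  obtain q where q: "p = [:- l, 1:] * q"
    using insert.prems[of l] by (auto simp: poly_eq_0_iff_dvd elim: dvdE)
  have "poly q k = 0" if "k \<in> \<Lambda>" for k
  proof -
    have "(k - l) * poly q k = 0" using insert.prems[of k] that by (simp add: q algebra_simps)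
    moreover have "k \<noteq> l" using that insert.hyps by auto
    ultimately show ?thesis by simp
  qed
  then have "(\<Prod>l\<in>\<Lambda>. [:- l, 1:]) dvd q" by (rule insert.IH)
  then have "[:- l, 1:] * (\<Prod>l\<in>\<Lambda>. [:- l, 1:]) dvd p"
    unfolding q by (intro mult_dvd_mono dvd_refl)
  then show ?case using insert.hyps by simp
qed

text \<open>
  A non-real complex root comes with its conjugate; the remainder of \<open>m\<close> modulo the corresponding
  real quadratic is linear with a non-real root, hence zero.
\<close>
lemma real_poly_factor:
  fixes m :: "real poly"
  assumes "degree m > 0"
  shows "(\<exists>l q. m = [:- l, 1:] * q) \<or> (\<exists>a b q. b \<noteq> 0 \<and> m = [:a\<^sup>2 + b\<^sup>2, - 2 * a, 1:] * q)"
proof -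
  let ?C = "map_poly complex_of_real"
  have "degree (?C m) = degree m" by (simp add: degree_map_poly)
  then have "\<not> constant (poly (?C m))" using assms by (simp add: constant_degree)
  then obtain z where z: "poly (?C m) z = 0" using fundamental_theorem_of_algebra by blast
  have C_add: "poly (?C (p + q)) z = poly (?C p) z + poly (?C q) z" for p q
    by (induction p q rule: poly_induct2) (simp_all add: map_poly_pCons algebra_simps)
  have C_smult: "poly (?C (smult c p)) z = of_real c * poly (?C p) z" for c p
    by (induction p) (simp_all add: map_poly_pCons algebra_simps)
  have C_mult: "poly (?C (p * q)) z = poly (?C p) z * poly (?C q) z" for p q
    by (induction p) (simp_all add: map_poly_pCons C_add C_smult algebra_simps)
  show ?thesis
  proof (cases "Im z = 0")
    case True
    then have "z = of_real (Re z)" by (simp add: complex_eq_iff)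
    moreover have "poly (?C m) (of_real (Re z)) = of_real (poly m (Re z))"
      by (induction m) (simp_all add: map_poly_pCons)
    ultimately have "poly m (Re z) = 0" using z by simp
    then show ?thesis by (metis dvdE poly_eq_0_iff_dvd)
  next
    case False
    let ?Q = "[:(Re z)\<^sup>2 + (Im z)\<^sup>2, - 2 * Re z, 1:]"
    have Qz: "poly (?C ?Q) z = 0"
      by (simp add: map_poly_pCons complex_eq_iff power2_eq_square algebra_simps)
    have "degree (m mod ?Q) < 2"
      using degree_mod_less[of ?Q m] by auto
    then have "coeff (m mod ?Q) (Suc (Suc n)) = 0" for n by (simp add: coeff_eq_0)
    then have "m mod ?Q = [:coeff (m mod ?Q) 0, coeff (m mod ?Q) 1:]"
      by (intro poly_eqI) (auto simp: coeff_pCons split: nat.split)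
    then obtain c d where cd: "m mod ?Q = [:c, d:]" by blast
    have "m = m div ?Q * ?Q + m mod ?Q" by (rule div_mult_mod_eq[symmetric])
    then have "poly (?C m) z = poly (?C (m mod ?Q)) z" using C_add C_mult Qz
      by (metis mult_zero_right add_0_left)
    then have "complex_of_real c + z * of_real d = 0"
      using z unfolding cd by (simp add: map_poly_pCons)
    then have "d = 0" "c = 0" using False by (auto simp: complex_eq_iff)
    then have "m mod ?Q = 0" using cd by simp
    then have "m = ?Q * (m div ?Q)" by (metis add_0_right mult_div_mod_eq)
    then show ?thesis using False by blast
  qed
qed

section \<open>Elementary properties of C*-algebras\<close>

context cstar_algebra
begin

lemma of_real_in_F [simp]: "complex_of_real r \<in> F"
  using scalar_field by auto

lemma zero_in_F [simp]: "0 \<in> F" and one_in_F [simp]: "1 \<in> F" and minus_one_in_F [simp]: "-1 \<in> F"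
  using of_real_in_F[of 0] of_real_in_F[of 1] of_real_in_F[of "-1"] by simp_all

lemma F_mult: "c \<in> F \<Longrightarrow> d \<in> F \<Longrightarrow> c * d \<in> F"
  and F_add: "c \<in> F \<Longrightarrow> d \<in> F \<Longrightarrow> c + d \<in> F"
  and F_inverse: "c \<in> F \<Longrightarrow> inverse c \<in> F"
  using scalar_field by (auto simp: complex_is_Real_iff)

lemma smul_zero_left [simp]: "smul 0 x = 0"
  using smul_of_real[of 0 x] by simp

lemma smul_one [simp]: "smul 1 x = x"
  using smul_of_real[of 1 x] by simp

lemma smul_zero_right [simp]: "c \<in> F \<Longrightarrow> smul c 0 = 0"
  using norm_smul[of c 0] by simp

lemma smul_minus_left: "c \<in> F \<Longrightarrow> smul (- c) x = - smul c x"
  using smul_smul[of "-1" c x] smul_of_real[of "-1" "smul c x"] by simp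

lemma smul_scaleR: "c \<in> F \<Longrightarrow> smul c (r *\<^sub>R x) = smul (c * of_real r) x"
  by (metis of_real_in_F smul_smul smul_of_real)

lemma scaleR_smul: "c \<in> F \<Longrightarrow> r *\<^sub>R smul c x = smul (of_real r * c) x"
  by (metis of_real_in_F smul_smul smul_of_real)

lemma star_scaleR: "star (r *\<^sub>R x) = r *\<^sub>R star x"
  using star_smul[of "of_real r" x] by (simp add: smul_of_real)

lemma star_0 [simp]: "star 0 = 0"
  using star_scaleR[of 0 0] by simp

lemma star_minus: "star (- x) = - star x"
  using star_scaleR[of "-1" x] by simp

lemma star_diff: "star (x - y) = star x - star y"
  using star_add[of x "- y"] by (simp add: star_minus)

lemma star_1 [simp]: "star 1 = 1"
  by (metis mult_1 mult_1_right star_mult star_star)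

lemma star_of_real [simp]: "star (of_real r) = of_real r"
  by (simp add: of_real_def star_scaleR)

lemma star_sum: "star (\<Sum>i\<in>I. f i) = (\<Sum>i\<in>I. star (f i))"
  by (induction I rule: infinite_finite_induct) (simp_all add: star_add)

lemma norm_star: "norm (star x) = norm x"
proof -
  have le: "norm y \<le> norm (star y)" for y
  proof (cases "y = 0")
    case False
    have "(norm y)\<^sup>2 \<le> norm (star y) * norm y"
      by (metis cstar_identity norm_mult_ineq)
    then show ?thesis using False by (simp add: power2_eq_square)
  qed simp
  show ?thesis using le[of x] le[of "star x"] by (simp add: star_star)
qed

lemma star_mult_self_eq_0: "star x * x = 0 \<Longrightarrow> x = 0"
  using cstar_identity[of x] by simp

lemma star_peval: "star h = h \<Longrightarrow> star (peval p h) = peval p h"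
proof (induction p)
  case (pCons c p)
  have "h * peval p h = peval p h * h"
    using peval_commute[of "[:0, 1:]" h p] by simp
  then show ?case using pCons by (simp add: star_add star_mult)
qed simp

text \<open>
  For real scalars this is part of the axioms.  For complex scalars, factor \<open>1 + x\<^sup>2 = (x - i) (x + i)\<close>: if
  \<open>x z = - i z\<close>, then \<open>z\<^sup>* x z\<close> is both \<open>- i z\<^sup>* z\<close> and, by taking adjoints, \<open>i z\<^sup>* z\<close>.
\<close>
lemma one_plus_square_cancel:
  assumes "star x = x" "(1 + x * x) * y = 0"
  shows "y = 0"
  using scalar_field
proof
  assume "F = \<real>"
  then obtain z where "z * (1 + x * x) = 1" using invertible_one_plus_star_mult assms(1) by metis
  then show ?thesis using assms(2) by (metis mult.assoc mult_1 mult_zero_right)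
next
  assume F: "F = UNIV"
  have eigen: "z = 0" if z: "x * z = smul c z" and c: "cnj c \<noteq> c" for z c
  proof -
    have "star z * x = smul (cnj c) (star z)"
      using arg_cong[OF z, of star] by (simp add: star_mult assms(1) star_smul F)
    then have "smul (cnj c) (star z * z) = smul c (star z * z)"
      using z F by (metis UNIV_I mult.assoc smul_mult_left smul_mult_right)
    then have "smul (cnj c - c) (star z * z) = 0"
      using smul_add_left[of "cnj c" "- c" "star z * z"] F by (simp add: smul_minus_left)
    then have "star z * z = 0" using norm_smul[of "cnj c - c" "star z * z"] F c by simp
    then show ?thesis by (rule star_mult_self_eq_0)
  qed
  let ?z = "x * y + smul \<i> y"
  have "x * (x * y) = - y" using assms(2) by (simp add: algebra_simps add_eq_0_iff)
  moreover have "smul \<i> (smul \<i> y) = - y" using F by (simp add: smul_smul smul_minus_left)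
  ultimately have "x * ?z = smul \<i> ?z"
    using F by (simp add: distrib_left smul_add_right smul_mult_right)
  then have "?z = 0" by (rule eigen) simp
  then have "x * y = smul (- \<i>) y" using F by (simp add: smul_minus_left add_eq_0_iff2)
  then show ?thesis by (rule eigen) simp
qed

lemma quadratic_cancel:
  assumes "star h = h" "b \<noteq> 0" "peval [:a\<^sup>2 + b\<^sup>2, - 2 * a, 1:] h * y = 0"
  shows "y = 0"
proof -
  let ?x = "(1 / b) *\<^sub>R (h - of_real a)"
  have "star ?x = ?x" using assms(1) by (simp add: star_scaleR star_diff)
  moreover have Q: "b\<^sup>2 *\<^sub>R (1 + ?x * ?x) = peval [:a\<^sup>2 + b\<^sup>2, - 2 * a, 1:] h"
    using assms(2)
    by (simp add: of_real_def algebra_simps power2_eq_square) (simp add: scaleR_add_left[symmetric])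
  have "b\<^sup>2 *\<^sub>R ((1 + ?x * ?x) * y) = 0"
    unfolding mult_scaleR_left[symmetric] Q by (rule assms(3))
  then have "(1 + ?x * ?x) * y = 0" using assms(2) by simp
  ultimately show ?thesis by (rule one_plus_square_cancel)
qed

end

section \<open>The spectral theorem for self-adjoint elements\<close>

context cstar_algebra
begin

text \<open>
  Factors of an annihilating polynomial that are irreducible quadratics can be cancelled, and
  repeated linear factors can be made simple.  Carrying the vector \<open>y\<close> along lets the induction peel
  off one factor at a time.
\<close>
lemma ex_distinct_linear_annihilator:
  assumes h: "star h = h" and "m \<noteq> 0" "peval m h * y = 0"
  shows "\<exists>\<Lambda>. finite \<Lambda> \<and> peval (\<Prod>l\<in>\<Lambda>. [:- l, 1:]) h * y = 0"
  using assms(2,3)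
proof (induction "degree m" arbitrary: m y rule: less_induct)
  case less
  consider "degree m = 0" | l q where "m = [:- l, 1:] * q"
    | a b q where "b \<noteq> 0" "m = [:a\<^sup>2 + b\<^sup>2, - 2 * a, 1:] * q"
    using real_poly_factor[of m] by blast
  then show ?case
  proof cases
    case 1
    then obtain c where "m = [:c:]" "c \<noteq> 0" using less.prems by (metis degree_eq_zeroE pCons_0_0)
    then have "y = 0" using less.prems by (simp add: of_real_def)
    then show ?thesis by (intro exI[of _ "{}"]) simp
  next
    case 2
    have q: "q \<noteq> 0" "degree q < degree m" using less.prems 2 by (auto simp: degree_mult_eq simp del: mult_pCons_left)
    let ?l = "h - of_real l"
    have l: "peval [:- l, 1:] h = ?l" by simp
    have "peval m h = peval q h * ?l"
      unfolding 2 mult.commute[of "[:- l, 1:]"] peval_mult l ..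
    then have "peval q h * (?l * y) = 0" using less.prems by (simp add: mult.assoc)
    from less.hyps[OF q(2) q(1) this]
    obtain \<Lambda> where \<Lambda>: "finite \<Lambda>" "peval (\<Prod>l\<in>\<Lambda>. [:- l, 1:]) h * (?l * y) = 0" by blast
    let ?P = "\<lambda>\<Lambda>. \<Prod>l\<in>\<Lambda>. [:- l, 1:] :: real poly"
    show ?thesis
    proof (cases "l \<in> \<Lambda>")
      case False
      then have P: "?P (insert l \<Lambda>) = ?P \<Lambda> * [:- l, 1:]"
        using \<Lambda>(1) by (simp add: prod.insert)
      have "peval (?P (insert l \<Lambda>)) h = peval (?P \<Lambda>) h * ?l"
        unfolding P peval_mult l ..
      then show ?thesis using \<Lambda> by (intro exI[of _ "insert l \<Lambda>"]) (simp add: mult.assoc)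
    next
      case True
      let ?z = "peval (?P \<Lambda>) h * y"
      have "?P \<Lambda> = [:- l, 1:] * ?P (\<Lambda> - {l})" using True \<Lambda>(1) by (metis prod.remove)
      then have z: "?z = ?l * (peval (?P (\<Lambda> - {l})) h * y)"
        by (simp only: l peval_mult mult.assoc)
      \<comment> \<open>A repeated factor \<open>h - l\<close> can be dropped because \<open>h - l\<close> is self-adjoint.\<close>
      have "?l * ?z = 0" using \<Lambda>(2) by (metis l peval_commute mult.assoc)
      moreover have "star ?l = ?l" using h by (simp add: star_diff)
      ultimately have "star ?z * ?z = 0"
        by (subst z) (simp add: star_mult mult.assoc)
      then have "?z = 0" by (rule star_mult_self_eq_0)
      then show ?thesis using \<Lambda>(1) by blast
    qed
  next
    case 3
    let ?Q = "[:a\<^sup>2 + b\<^sup>2, - 2 * a, 1:]"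
    have q: "q \<noteq> 0" using less.prems 3 by auto
    have "degree m = 2 + degree q" unfolding 3 using q by (subst degree_mult_eq) auto
    then have dq: "degree q < degree m" by simp
    have "peval q h * (peval ?Q h * y) = 0"
      using less.prems unfolding 3 mult.commute[of ?Q] peval_mult by (simp only: mult.assoc)
    from less.hyps[OF dq q this]
    obtain \<Lambda> where \<Lambda>: "finite \<Lambda>" "peval (\<Prod>l\<in>\<Lambda>. [:- l, 1:]) h * (peval ?Q h * y) = 0" by blast
    then have "peval ?Q h * (peval (\<Prod>l\<in>\<Lambda>. [:- l, 1:]) h * y) = 0"
      by (metis peval_commute mult.assoc)
    then have "peval (\<Prod>l\<in>\<Lambda>. [:- l, 1:]) h * y = 0"
      by (rule quadratic_cancel[OF h 3(1)])
    then show ?thesis using \<Lambda>(1) by blast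
  qed
qed

definition spectral_decomposition :: "'a \<Rightarrow> real set \<Rightarrow> (real \<Rightarrow> 'a) \<Rightarrow> bool" where
  "spectral_decomposition h \<Lambda> e \<longleftrightarrow>
     finite \<Lambda> \<and> (\<forall>l\<in>\<Lambda>. e l \<noteq> 0 \<and> star (e l) = e l) \<and>
     (\<forall>l\<in>\<Lambda>. \<forall>k\<in>\<Lambda>. e l * e k = (if l = k then e l else 0)) \<and>
     (\<Sum>l\<in>\<Lambda>. e l) = 1 \<and> h = (\<Sum>l\<in>\<Lambda>. l *\<^sub>R e l)"

lemma ex_spectral_decomposition_if_annihilated:
  assumes h: "star h = h" and "m \<noteq> 0" "peval m h = 0"
  shows "\<exists>\<Lambda> e. spectral_decomposition h \<Lambda> e"
proof -
  obtain \<Lambda> where \<Lambda>: "finite \<Lambda>" "peval (\<Prod>l\<in>\<Lambda>. [:- l, 1:]) h = 0"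
    using ex_distinct_linear_annihilator[OF h assms(2), of 1] assms(3) by auto
  have eqI: "peval p h = peval q h" if "\<And>l. l \<in> \<Lambda> \<Longrightarrow> poly p l = poly q l" for p q
  proof -
    have "(\<Prod>l\<in>\<Lambda>. [:- l, 1:]) dvd p - q" using that \<Lambda>(1) by (intro prod_linear_dvd) auto
    then have "peval (p - q) h = 0" using \<Lambda>(2) by (auto simp: peval_mult elim!: dvdE)
    then show ?thesis by (simp add: peval_diff)
  qed
  \<comment> \<open>The spectral projections are the Lagrange basis polynomials evaluated at \<open>h\<close>.\<close>
  define L where "L l = smult (1 / (\<Prod>k\<in>\<Lambda>-{l}. l - k)) (\<Prod>k\<in>\<Lambda>-{l}. [:- k, 1:])" for l
  have L: "poly (L l) k = (if l = k then 1 else 0)" if "l \<in> \<Lambda>" "k \<in> \<Lambda>" for l k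
  proof (cases "l = k")
    case True
    then show ?thesis using \<Lambda>(1) by (simp add: L_def poly_prod)
  next
    case False
    then have "(\<Prod>j\<in>\<Lambda>-{l}. k - j) = 0" using \<Lambda>(1) that by (intro prod_zero) auto
    then show ?thesis using False by (simp add: L_def poly_prod)
  qed
  define e where "e l = peval (L l) h" for l
  have se: "star (e l) = e l" for l unfolding e_def by (rule star_peval[OF h])
  have ee: "e l * e k = (if l = k then e l else 0)" if "l \<in> \<Lambda>" "k \<in> \<Lambda>" for l k
  proof -
    have "peval (L l * L k) h = peval (if l = k then L l else 0) h"
      using that by (intro eqI) (auto simp: L)
    then show ?thesis by (auto simp: e_def peval_mult)
  qed
  have "peval (\<Sum>l\<in>\<Lambda>. L l) h = peval 1 h"
    using \<Lambda>(1) by (intro eqI) (simp add: poly_sum L)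
  then have e1: "(\<Sum>l\<in>\<Lambda>. e l) = 1" by (simp add: peval_sum e_def)
  have "peval (\<Sum>l\<in>\<Lambda>. smult l (L l)) h = peval [:0, 1:] h"
    using \<Lambda>(1) by (intro eqI) (simp add: poly_sum L if_distrib cong: if_cong)
  then have eh: "(\<Sum>l\<in>\<Lambda>. l *\<^sub>R e l) = h" by (simp add: peval_sum peval_smult e_def)
  let ?\<Lambda> = "{l \<in> \<Lambda>. e l \<noteq> 0}"
  have "(\<Sum>l\<in>?\<Lambda>. e l) = 1"
    unfolding e1[symmetric] by (rule sum.mono_neutral_left[OF \<Lambda>(1)]) auto
  moreover have "(\<Sum>l\<in>?\<Lambda>. l *\<^sub>R e l) = h"
    unfolding eh[symmetric] by (rule sum.mono_neutral_left[OF \<Lambda>(1)]) auto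
  ultimately have "spectral_decomposition h ?\<Lambda> e"
    using \<Lambda>(1) se ee by (simp add: spectral_decomposition_def)
  then show ?thesis by blast
qed

lemma spectral_mult_left:
  assumes "spectral_decomposition h \<Lambda> e" "k \<in> \<Lambda>"
  shows "(\<Sum>l\<in>\<Lambda>. f l *\<^sub>R e l) * e k = f k *\<^sub>R e k"
proof -
  have "(\<Sum>l\<in>\<Lambda>. f l *\<^sub>R e l) * e k = (\<Sum>l\<in>\<Lambda>. if l = k then f l *\<^sub>R e l else 0)"
    using assms unfolding sum_distrib_right
    by (intro sum.cong) (auto simp: spectral_decomposition_def)
  then show ?thesis using assms by (simp add: spectral_decomposition_def)
qed

lemma spectral_mult:
  assumes "spectral_decomposition h \<Lambda> e"
  shows "(\<Sum>l\<in>\<Lambda>. f l *\<^sub>R e l) * (\<Sum>l\<in>\<Lambda>. g l *\<^sub>R e l) = (\<Sum>l\<in>\<Lambda>. (f l * g l) *\<^sub>R e l)"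
  unfolding sum_distrib_left[of _ _ \<Lambda>]
  by (intro sum.cong) (simp_all add: spectral_mult_left[OF assms] mult.commute)

lemma spectral_const:
  assumes "spectral_decomposition h \<Lambda> e"
  shows "(\<Sum>l\<in>\<Lambda>. c *\<^sub>R e l) = of_real c"
  using assms by (simp add: spectral_decomposition_def scaleR_sum_right[symmetric] of_real_def)

lemma spectral_nonempty: "spectral_decomposition h \<Lambda> e \<Longrightarrow> \<Lambda> \<noteq> {}"
  by (auto simp: spectral_decomposition_def)

lemma spectral_eigen:
  assumes "spectral_decomposition h \<Lambda> e" "k \<in> \<Lambda>"
  shows "h * e k = k *\<^sub>R e k"
  using spectral_mult_left[OF assms, of "\<lambda>l. l"] assms(1) by (simp add: spectral_decomposition_def)

lemma spectral_star:
  assumes "spectral_decomposition h \<Lambda> e"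
  shows "star (\<Sum>l\<in>\<Lambda>. f l *\<^sub>R e l) = (\<Sum>l\<in>\<Lambda>. f l *\<^sub>R e l)"
  using assms by (simp add: star_sum star_scaleR spectral_decomposition_def)

lemma norm_projection:
  assumes "spectral_decomposition h \<Lambda> e" "k \<in> \<Lambda>"
  shows "norm (e k) = 1"
proof -
  have "e k \<noteq> 0" "star (e k) * e k = e k" using assms by (auto simp: spectral_decomposition_def)
  then show ?thesis using cstar_identity[of "e k"] by (simp add: power2_eq_square)
qed

lemma norm_self_adjoint_power:
  assumes "star x = x"
  shows "norm (x ^ (2 ^ n)) = norm x ^ (2 ^ n)"
proof (induction n)
  case (Suc n)
  have sp: "star (x ^ k) = x ^ k" for k
    by (induction k) (simp_all add: star_mult assms power_commutes)
  have "norm (x ^ (2 ^ Suc n)) = norm (star (x ^ 2 ^ n) * x ^ 2 ^ n)"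
    by (simp add: sp power_add[symmetric] mult_2)
  also have "\<dots> = norm x ^ (2 ^ Suc n)"
    unfolding cstar_identity Suc power_mult[symmetric] by (simp add: mult.commute)
  finally show ?case .
qed simp

text \<open>
  The triangle inequality loses a factor \<open>card \<Lambda>\<close>; applied to the powers \<open>x ^ 2 ^ n\<close>, on which the
  norm is multiplicative, this factor disappears in the limit.
\<close>
lemma spectral_norm_le:
  assumes sd: "spectral_decomposition h \<Lambda> e" and M: "\<And>l. l \<in> \<Lambda> \<Longrightarrow> \<bar>f l\<bar> \<le> M"
  shows "norm (\<Sum>l\<in>\<Lambda>. f l *\<^sub>R e l) \<le> M"
proof (rule ccontr)
  let ?x = "\<Sum>l\<in>\<Lambda>. f l *\<^sub>R e l"
  assume gt: "\<not> norm ?x \<le> M"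
  obtain k where "k \<in> \<Lambda>" using spectral_nonempty[OF sd] by blast
  then have M0: "0 \<le> M" using M[of k] by linarith
  have powers: "?x ^ n = (\<Sum>l\<in>\<Lambda>. (f l ^ n) *\<^sub>R e l)" for n
    by (induction n) (simp_all add: spectral_mult[OF sd] spectral_const[OF sd, of 1, simplified])
  have bound: "norm ?x ^ (2 ^ n) \<le> card \<Lambda> * M ^ (2 ^ n)" for n
  proof -
    have "norm ?x ^ (2 ^ n) = norm (\<Sum>l\<in>\<Lambda>. (f l ^ 2 ^ n) *\<^sub>R e l)"
      using norm_self_adjoint_power[OF spectral_star[OF sd], of f n] by (simp add: powers)
    also have "\<dots> \<le> (\<Sum>l\<in>\<Lambda>. norm ((f l ^ 2 ^ n) *\<^sub>R e l))" by (rule norm_sum)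
    also have "\<dots> \<le> (\<Sum>l\<in>\<Lambda>. M ^ 2 ^ n)"
      using M by (intro sum_mono) (auto simp: norm_projection[OF sd] power_abs intro!: power_mono)
    finally show ?thesis by simp
  qed
  have "M > 0"
  proof (rule ccontr)
    assume "\<not> M > 0"
    then show False using bound[of 0] M0 gt by auto
  qed
  then have r: "norm ?x / M > 1" using gt by simp
  obtain n where n: "card \<Lambda> < (norm ?x / M) ^ n" using real_arch_pow[OF r] by blast
  have "(norm ?x / M) ^ n \<le> (norm ?x / M) ^ (2 ^ n)"
    using r by (intro power_increasing) (auto intro: less_imp_le)
  also have "\<dots> \<le> card \<Lambda>"
    using bound[of n] \<open>M > 0\<close> by (simp add: power_divide divide_le_eq)
  finally show False using n by simp
qed

lemma norm_mult_projection_le: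
  assumes "spectral_decomposition h \<Lambda> e" "k \<in> \<Lambda>"
  shows "norm (x * e k) \<le> norm x"
  using norm_mult_ineq[of x "e k"] norm_projection[OF assms] by simp

lemma spectral_norm_ge:
  assumes "spectral_decomposition h \<Lambda> e" "k \<in> \<Lambda>"
  shows "\<bar>f k\<bar> \<le> norm (\<Sum>l\<in>\<Lambda>. f l *\<^sub>R e l)"
  using norm_mult_projection_le[OF assms, of "\<Sum>l\<in>\<Lambda>. f l *\<^sub>R e l"]
  by (simp add: spectral_mult_left[OF assms] norm_projection[OF assms])

lemma spectral_norm_attained:
  assumes "spectral_decomposition h \<Lambda> e"
  shows "\<exists>k\<in>\<Lambda>. norm (\<Sum>l\<in>\<Lambda>. f l *\<^sub>R e l) = \<bar>f k\<bar>"
proof -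
  let ?m = "Max ((\<lambda>l. \<bar>f l\<bar>) ` \<Lambda>)"
  have fin: "finite ((\<lambda>l. \<bar>f l\<bar>) ` \<Lambda>)" "(\<lambda>l. \<bar>f l\<bar>) ` \<Lambda> \<noteq> {}"
    using assms spectral_nonempty[OF assms] by (auto simp: spectral_decomposition_def)
  then obtain k where k: "k \<in> \<Lambda>" "\<bar>f k\<bar> = ?m" using Max_in[OF fin] by force
  have "norm (\<Sum>l\<in>\<Lambda>. f l *\<^sub>R e l) \<le> \<bar>f k\<bar>"
    by (intro spectral_norm_le[OF assms]) (simp add: k(2) fin)
  then show ?thesis using spectral_norm_ge[OF assms k(1), of f] k(1) by force
qed

end

section \<open>Positivity\<close>

context cstar_algebra
begin

text \<open>
  A norm condition that says that the spectrum is non-negative (\<open>nonneg_iff_eigenvalues\<close> below).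
  In this form closure under addition is just the triangle inequality.
\<close>
definition nonneg :: "'a \<Rightarrow> bool" where
  "nonneg a \<longleftrightarrow> star a = a \<and> (\<exists>t. norm (of_real t - a) \<le> t)"

lemma nonneg_add:
  assumes "nonneg a" "nonneg b"
  shows "nonneg (a + b)"
proof -
  obtain s t where st: "norm (of_real s - a) \<le> s" "norm (of_real t - b) \<le> t"
    using assms by (auto simp: nonneg_def)
  have "norm (of_real (s + t) - (a + b)) \<le> norm (of_real s - a) + norm (of_real t - b)"
    using norm_triangle_ineq[of "of_real s - a" "of_real t - b"] by (simp add: algebra_simps)
  then have "norm (of_real (s + t) - (a + b)) \<le> s + t" using st by linarith
  moreover have "star (a + b) = a + b" using assms by (simp add: nonneg_def star_add)
  ultimately show ?thesis unfolding nonneg_def by blast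
qed

lemma spectral_self_adjoint: "spectral_decomposition h \<Lambda> e \<Longrightarrow> star h = h"
  using spectral_star[of h \<Lambda> e "\<lambda>l. l"] by (simp add: spectral_decomposition_def)

lemma spectral_id: "spectral_decomposition h \<Lambda> e \<Longrightarrow> (\<Sum>l\<in>\<Lambda>. l *\<^sub>R e l) = h"
  by (simp add: spectral_decomposition_def)

lemma spectral_shift:
  assumes "spectral_decomposition h \<Lambda> e"
  shows "of_real t - h = (\<Sum>l\<in>\<Lambda>. (t - l) *\<^sub>R e l)"
  by (simp add: scaleR_diff_left sum_subtractf spectral_const[OF assms] spectral_id[OF assms])

lemma abs_eigenvalue_le:
  assumes "spectral_decomposition h \<Lambda> e" "l \<in> \<Lambda>"
  shows "\<bar>l\<bar> \<le> norm h"
  using spectral_norm_ge[OF assms, of "\<lambda>l. l"] by (simp add: spectral_id[OF assms(1)])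

lemma norm_shift_le:
  assumes sd: "spectral_decomposition h \<Lambda> e" and nn: "\<And>l. l \<in> \<Lambda> \<Longrightarrow> 0 \<le> l"
  shows "norm (of_real (norm h) - h) \<le> norm h"
  unfolding spectral_shift[OF sd]
proof (rule spectral_norm_le[OF sd])
  fix l assume "l \<in> \<Lambda>"
  then show "\<bar>norm h - l\<bar> \<le> norm h" using nn abs_eigenvalue_le[OF sd, of l] by force
qed

lemma nonneg_iff_eigenvalues:
  assumes sd: "spectral_decomposition h \<Lambda> e"
  shows "nonneg h \<longleftrightarrow> (\<forall>l\<in>\<Lambda>. 0 \<le> l)"
proof
  assume "nonneg h"
  then obtain t where t: "norm (of_real t - h) \<le> t" by (auto simp: nonneg_def)
  show "\<forall>l\<in>\<Lambda>. 0 \<le> l"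
  proof
    fix l assume "l \<in> \<Lambda>"
    then have "\<bar>t - l\<bar> \<le> t"
      using spectral_norm_ge[OF sd, of l "\<lambda>l. t - l"] t by (simp add: spectral_shift[OF sd])
    then show "0 \<le> l" by linarith
  qed
next
  assume nn: "\<forall>l\<in>\<Lambda>. 0 \<le> l"
  have "norm (of_real (norm h) - h) \<le> norm h"
    using nn by (intro norm_shift_le[OF sd]) auto
  then show "nonneg h" using spectral_self_adjoint[OF sd] by (auto simp: nonneg_def)
qed

lemma norm_unitary: "unitary star u \<Longrightarrow> norm u = 1"
  using cstar_identity[of u] norm_ge_zero[of u] by (simp add: unitary_def power2_eq_1_iff)

lemma norm_unitary_mult:
  assumes "unitary star u"
  shows "norm (u * x) = norm x"
proof (rule antisym)
  show "norm (u * x) \<le> norm x"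
    using norm_mult_ineq[of u x] norm_unitary[OF assms] by simp
  have "x = star u * (u * x)" using assms by (simp add: unitary_def mult.assoc[symmetric])
  then show "norm x \<le> norm (u * x)"
    using norm_mult_ineq[of "star u" "u * x"] norm_unitary[OF assms] norm_star[of u] by simp
qed

lemma unitary_star: "unitary star u \<Longrightarrow> unitary star (star u)"
  by (simp add: unitary_def star_star)

lemma unitary_1: "unitary star 1"
  by (simp add: unitary_def)

lemma unitary_mult:
  assumes "unitary star u" "unitary star v"
  shows "unitary star (u * v)"
  using assms unfolding unitary_def star_mult by (metis mult.assoc mult_1)

lemma bounded_linear_star: "bounded_linear star"
  by (rule bounded_linear_intro[where K = 1]) (simp_all add: star_add star_scaleR norm_star)

end

context finite_dim_cstar_algebra
begin

lemma ex_finite_real_spanning_set: "\<exists>S. finite S \<and> span S = (UNIV :: 'a set)"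
proof -
  obtain S where S: "finite S" "\<And>x. \<exists>c. (\<forall>s\<in>S. c s \<in> F) \<and> x = (\<Sum>s\<in>S. smul (c s) s)"
    using finite_dim by blast
  let ?S = "S \<union> smul \<i> ` S"
  have smul_span: "smul c s \<in> span ?S" if "s \<in> S" "c \<in> F" for c s
    using scalar_field
  proof
    assume "F = \<real>"
    then obtain r where "c = of_real r" using \<open>c \<in> F\<close> by (auto elim: Reals_cases)
    then show ?thesis using that by (simp add: smul_of_real span_base span_scale)
  next
    assume F: "F = UNIV"
    have "smul c s = smul (of_real (Re c) + of_real (Im c) * \<i>) s"
      by (simp add: complex_eq mult.commute flip: complex_eq)
    also have "\<dots> = Re c *\<^sub>R s + Im c *\<^sub>R smul \<i> s"
      using F by (simp add: smul_add_left smul_of_real scaleR_smul)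
    finally show ?thesis using that by (simp add: span_add span_base span_scale)
  qed
  have "x \<in> span ?S" for x
  proof -
    obtain c where "\<forall>s\<in>S. c s \<in> F" "x = (\<Sum>s\<in>S. smul (c s) s)" using S(2) by blast
    then show ?thesis using smul_span by (auto intro: span_sum)
  qed
  then show ?thesis using S(1) by (intro exI[of _ ?S]) auto
qed

lemma annihilating_poly:
  fixes x :: 'a
  obtains m where "m \<noteq> 0" "peval m x = 0"
  using ex_annihilating_poly ex_finite_real_spanning_set by blast

lemma left_inverse_commute:
  fixes x y :: 'a
  assumes "x * y = 1"
  shows "y * x = 1"
  using annihilating_poly[of y] left_inverse_imp_right_inverse assms by metis

lemma bounded_has_convergent_subsequence:
  fixes x :: "nat \<Rightarrow> 'a"
  assumes "bounded (range x)"
  obtains l r where "strict_mono r" "(x \<circ> r) \<longlonglongrightarrow> l"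
  using bounded_sequence_in_finite_span[of _ x] ex_finite_real_spanning_set assms
  by (metis UNIV_I)

theorem spectral_theorem:
  assumes "star h = h"
  obtains \<Lambda> e where "spectral_decomposition h \<Lambda> e"
  using annihilating_poly[of h] ex_spectral_decomposition_if_annihilated[OF assms] by metis

lemma nonneg_square:
  assumes "star x = x"
  shows "nonneg (x * x)"
proof -
  obtain \<Lambda> e where sd: "spectral_decomposition x \<Lambda> e" using spectral_theorem[OF assms] .
  have xx: "x * x = (\<Sum>l\<in>\<Lambda>. (l * l) *\<^sub>R e l)"
    using spectral_mult[OF sd, of "\<lambda>l. l" "\<lambda>l. l"] by (simp add: spectral_id[OF sd])
  have "of_real (norm (x * x)) - x * x = (\<Sum>l\<in>\<Lambda>. (norm (x * x) - l * l) *\<^sub>R e l)"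
    by (simp add: scaleR_diff_left sum_subtractf spectral_const[OF sd] xx)
  also have "norm \<dots> \<le> norm (x * x)"
  proof (rule spectral_norm_le[OF sd])
    fix l assume l: "l \<in> \<Lambda>"
    have "l * l \<le> norm (x * x)"
      using spectral_norm_ge[OF sd l, of "\<lambda>l. l * l"] by (simp add: xx)
    moreover have "0 \<le> l * l" by simp
    ultimately show "\<bar>norm (x * x) - l * l\<bar> \<le> norm (x * x)" by linarith
  qed
  finally show ?thesis using assms by (auto simp: nonneg_def star_mult)
qed

lemma nonneg_antisym:
  assumes "nonneg a" "nonneg (- a)"
  shows "a = 0"
proof -
  obtain \<Lambda> e where sd: "spectral_decomposition a \<Lambda> e"
    using spectral_theorem assms(1) by (auto simp: nonneg_def)
  obtain t where t: "norm (of_real t - - a) \<le> t" using assms(2) by (auto simp: nonneg_def)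
  have "l = 0" if l: "l \<in> \<Lambda>" for l
  proof -
    have "of_real t - - a = (\<Sum>l\<in>\<Lambda>. (t + l) *\<^sub>R e l)"
      by (simp add: scaleR_add_left sum.distrib spectral_const[OF sd] spectral_id[OF sd])
    then have "\<bar>t + l\<bar> \<le> t" using spectral_norm_ge[OF sd l, of "\<lambda>l. t + l"] t by simp
    moreover have "0 \<le> l" using nonneg_iff_eigenvalues[OF sd] assms(1) l by blast
    ultimately show ?thesis by linarith
  qed
  then show ?thesis using spectral_id[OF sd] by (metis (no_types, lifting) scaleR_eq_0_iff sum.neutral)
qed

text \<open>
  A negative eigenvalue of \<open>x\<^sup>* x\<close> gives \<open>c\<close> with \<open>c\<^sup>* c = - e\<close> for a non-zero projection \<open>e\<close>.  Over
  the reals, invertibility of \<open>1 + c\<^sup>* c\<close> excludes this.  Over the complex numbers, \<open>- c c\<^sup>*\<close> is a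
  projection as well, while \<open>c\<^sup>* c + c c\<^sup>*\<close> is twice the sum of the squares of the real and
  imaginary parts of \<open>c\<close> (Kaplansky's argument).
\<close>
theorem nonneg_star_mult: "nonneg (star x * x)"
proof -
  have "star (star x * x) = star x * x" by (simp add: star_mult star_star)
  then obtain \<Lambda> e where sd: "spectral_decomposition (star x * x) \<Lambda> e" using spectral_theorem by blast
  have "0 \<le> l" if l: "l \<in> \<Lambda>" for l
  proof (rule ccontr)
    assume "\<not> 0 \<le> l"
    define s where "s = - l"
    have s: "s > 0" using \<open>\<not> 0 \<le> l\<close> by (simp add: s_def)
    let ?e = "e l" and ?y = "(1 / sqrt s) *\<^sub>R x"
    have e: "?e \<noteq> 0" "star ?e = ?e" "?e * ?e = ?e"
      using sd l by (auto simp: spectral_decomposition_def)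
    have "star ?y * ?y = (1 / s) *\<^sub>R (star x * x)"
      using s by (simp add: star_scaleR)
    then have yye: "star ?y * ?y * ?e = - ?e"
      using spectral_eigen[OF sd l] s by (simp add: s_def)
    show False
      using scalar_field
    proof
      assume "F = \<real>"
      then obtain z where z: "z * (1 + star ?y * ?y) = 1"
        using invertible_one_plus_star_mult by metis
      have "(1 + star ?y * ?y) * ?e = 0" using yye by (simp only: distrib_right) simp
      then have "?e = 0" using z by (metis mult.assoc mult_1 mult_zero_right)
      then show False using e by simp
    next
      assume F: "F = UNIV"
      define c where "c = ?y * ?e"
      have "star c * c = ?e * (star ?y * ?y * ?e)"
        unfolding c_def star_mult e(2) by (simp only: mult.assoc)
      then have cc: "star c * c = - ?e" unfolding yye by (simp add: e(3))
      have ce: "c * ?e = c" by (simp add: c_def mult.assoc e(3))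
      define f where "f = c * star c"
      have "f * f = c * (star c * c) * star c" by (simp add: f_def mult.assoc)
      then have ff: "f * f = - f" by (simp add: cc ce f_def)
      have sf: "star f = f" by (simp add: f_def star_mult star_star)
      \<comment> \<open>\<open>h\<close> and \<open>k\<close> are, up to sign, twice the real and imaginary parts of \<open>c\<close>.\<close>
      define h where "h = c + star c"
      define k where "k = smul \<i> (c - star c)"
      have h: "star h = h" by (simp add: h_def star_add star_star add.commute)
      have "star k = smul (- \<i>) (star c - c)" using F by (simp add: k_def star_smul star_diff star_star)
      also have "\<dots> = smul (- \<i>) (smul (- 1) (c - star c))"
        using smul_of_real[of "-1" "c - star c"] by simp
      also have "\<dots> = k" unfolding k_def using F by (subst smul_smul) auto
      finally have k: "star k = k" .
      have "k * k = smul \<i> (smul \<i> ((c - star c) * (c - star c)))"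
        unfolding k_def using F by (simp add: smul_mult_left smul_mult_right)
      also have "\<dots> = - ((c - star c) * (c - star c))"
        using F by (simp add: smul_smul smul_minus_left)
      finally have kk: "k * k = - ((c - star c) * (c - star c))" .
      have "h * h + k * k = (c * star c + c * star c) + (star c * c + star c * c)"
        unfolding kk h_def by (simp add: algebra_simps)
      then have sum: "- ?e = (h * h + k * k) + ((f * f + f * f) + ?e * ?e)"
        unfolding cc ff e(3) f_def[symmetric] by simp
      have "nonneg (?e * ?e)" by (rule nonneg_square[OF e(2)])
      moreover have "nonneg (- ?e)"
        unfolding sum by (intro nonneg_add nonneg_square h k sf e)
      ultimately have "?e = 0" unfolding e(3) by (rule nonneg_antisym)
      then show False using e by simp
    qed
  qed
  then show ?thesis using nonneg_iff_eigenvalues[OF sd] by blast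
qed

lemma spectral_decomposition_star_mult:
  obtains \<Lambda> e where "spectral_decomposition (star x * x) \<Lambda> e" "\<And>l. l \<in> \<Lambda> \<Longrightarrow> 0 \<le> l"
proof -
  have "nonneg (star x * x)" by (rule nonneg_star_mult)
  moreover from this obtain \<Lambda> e where "spectral_decomposition (star x * x) \<Lambda> e"
    using spectral_theorem by (auto simp: nonneg_def)
  ultimately show thesis using that nonneg_iff_eigenvalues by blast
qed

lemma norm_star_mult_add_ge:
  assumes "t \<ge> 0"
  shows "(norm x)\<^sup>2 + t \<le> norm (star x * x + of_real t)"
proof -
  obtain \<Lambda> e where sd: "spectral_decomposition (star x * x) \<Lambda> e" and nn: "\<And>l. l \<in> \<Lambda> \<Longrightarrow> 0 \<le> l"
    using spectral_decomposition_star_mult by blast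
  obtain k where k: "k \<in> \<Lambda>" "norm (star x * x) = \<bar>k\<bar>"
    using spectral_norm_attained[OF sd, of "\<lambda>l. l"] by (auto simp: spectral_id[OF sd])
  have "star x * x + of_real t = (\<Sum>l\<in>\<Lambda>. (l + t) *\<^sub>R e l)"
    by (simp add: scaleR_add_left sum.distrib spectral_const[OF sd] spectral_id[OF sd])
  then have "\<bar>k + t\<bar> \<le> norm (star x * x + of_real t)"
    using spectral_norm_ge[OF sd k(1), of "\<lambda>l. l + t"] by simp
  then show ?thesis using k nn[OF k(1)] by (simp add: cstar_identity)
qed

end

section \<open>Polar decomposition\<close>

context finite_dim_cstar_algebra
begin

text \<open>
  Here \<open>h\<close> is the square root of \<open>y\<^sup>* y\<close> and \<open>U = y h\<^sup>-\<^sup>1\<close>.  The factor \<open>h\<close> is positive as the square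
  of its own square root.
\<close>
lemma polar_decomposition_invertible:
  assumes "z * y = 1"
  shows "\<exists>U h. unitary star U \<and> y = U * h \<and> nonneg h"
proof -
  obtain \<Lambda> e where sd: "spectral_decomposition (star y * y) \<Lambda> e" and nn: "\<And>l. l \<in> \<Lambda> \<Longrightarrow> 0 \<le> l"
    using spectral_decomposition_star_mult by blast
  have pos: "0 < l" if l: "l \<in> \<Lambda>" for l
  proof -
    have "l \<noteq> 0"
    proof
      assume "l = 0"
      have "star (y * e l) * (y * e l) = star (e l) * ((star y * y) * e l)"
        by (simp only: star_mult mult.assoc)
      also have "\<dots> = 0" using spectral_eigen[OF sd l] \<open>l = 0\<close> by simp
      finally have "y * e l = 0" by (rule star_mult_self_eq_0)
      then have "e l = 0" using assms by (metis mult.assoc mult_1 mult_zero_right)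
      then show False using sd l by (simp add: spectral_decomposition_def)
    qed
    then show ?thesis using nn[OF l] by simp
  qed
  define h where "h = (\<Sum>l\<in>\<Lambda>. sqrt l *\<^sub>R e l)"
  define k where "k = (\<Sum>l\<in>\<Lambda>. (1 / sqrt l) *\<^sub>R e l)"
  have sa: "star h = h" "star k = k" unfolding h_def k_def by (rule spectral_star[OF sd])+
  have "h * k = (\<Sum>l\<in>\<Lambda>. 1 *\<^sub>R e l)" "k * h = (\<Sum>l\<in>\<Lambda>. 1 *\<^sub>R e l)"
    unfolding h_def k_def spectral_mult[OF sd] using pos by (intro sum.cong; force)+
  then have hk: "h * k = 1" "k * h = 1" using spectral_const[OF sd, of 1] by simp_all
  have "h * h = (\<Sum>l\<in>\<Lambda>. l *\<^sub>R e l)"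
    unfolding h_def spectral_mult[OF sd] using pos by (intro sum.cong) (auto simp: less_imp_le)
  then have hh: "h * h = star y * y" by (simp add: spectral_id[OF sd])
  define r where "r = (\<Sum>l\<in>\<Lambda>. sqrt (sqrt l) *\<^sub>R e l)"
  have "star r = r" unfolding r_def by (rule spectral_star[OF sd])
  moreover have "h = r * r"
    unfolding h_def r_def spectral_mult[OF sd] using pos by (intro sum.cong) (auto simp: less_imp_le)
  ultimately have "nonneg h" using nonneg_square by simp
  have "star (y * k) * (y * k) = k * (star y * y) * k" by (simp add: star_mult sa mult.assoc)
  also have "\<dots> = (k * h) * (h * k)" unfolding hh[symmetric] by (simp only: mult.assoc)
  finally have u: "star (y * k) * (y * k) = 1" by (simp add: hk)
  then have "unitary star (y * k)" using left_inverse_commute[OF u] by (simp add: unitary_def)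
  moreover have "y = (y * k) * h" by (simp add: mult.assoc hk)
  ultimately show ?thesis using \<open>nonneg h\<close> by blast
qed

text \<open>With \<open>t = norm a\<close>, the condition defining \<^const>\<open>nonneg\<close> is visibly closed under limits.\<close>
lemma nonneg_iff_norm:
  "nonneg a \<longleftrightarrow> star a = a \<and> norm (of_real (norm a) - a) \<le> norm a"
proof
  assume nn: "nonneg a"
  then obtain \<Lambda> e where sd: "spectral_decomposition a \<Lambda> e"
    using spectral_theorem by (auto simp: nonneg_def)
  have "norm (of_real (norm a) - a) \<le> norm a"
    using nn nonneg_iff_eigenvalues[OF sd] by (intro norm_shift_le[OF sd]) auto
  then show "star a = a \<and> norm (of_real (norm a) - a) \<le> norm a" using nn by (simp add: nonneg_def)
qed (auto simp: nonneg_def)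

lemma tendsto_star: "(f \<longlongrightarrow> l) G \<Longrightarrow> ((\<lambda>n. star (f n)) \<longlongrightarrow> star l) G"
  by (rule bounded_linear.tendsto[OF bounded_linear_star])

text \<open>
  All but finitely many shifts \<open>x - r\<close> are invertible.  As \<open>r\<close> tends to \<open>0\<close>, their unitary factors
  have a limit point, and positivity passes to the limit.
\<close>
theorem polar_decomposition:
  obtains U h where "unitary star U" "x = U * h" "nonneg h"
proof -
  obtain m where m: "m \<noteq> 0" "peval m x = 0" using annihilating_poly .
  have "\<exists>r. 0 < r \<and> r < 1 / Suc n \<and> poly m r \<noteq> 0" for n
  proof -
    have "infinite {0<..<1 / real (Suc n)}" by (simp add: infinite_Ioo)
    then have "\<not> {0<..<1 / real (Suc n)} \<subseteq> {r. poly m r = 0}"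
      using poly_roots_finite[OF m(1)] finite_subset by blast
    then show ?thesis by auto
  qed
  then obtain r where r: "\<And>n. 0 < r n" "\<And>n. r n < 1 / Suc n" "\<And>n. poly m (r n) \<noteq> 0" by metis
  have "r \<longlonglongrightarrow> 0"
    by (rule tendsto_sandwich[OF _ _ tendsto_const lim_inverse_n'[THEN LIMSEQ_Suc]])
       (use r in \<open>auto intro!: always_eventually less_imp_le simp del: of_nat_Suc\<close>)
  let ?y = "\<lambda>n. x - of_real (r n)"
  have "\<forall>n. \<exists>U h. unitary star U \<and> ?y n = U * h \<and> nonneg h"
    using non_root_imp_left_invertible[OF m(2)] r(3) polar_decomposition_invertible by blast
  then obtain U h where Uh: "\<And>n. unitary star (U n)" "\<And>n. ?y n = U n * h n" "\<And>n. nonneg (h n)"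
    by metis
  have "bounded (range U)" using norm_unitary[OF Uh(1)] by (auto simp: bounded_iff)
  then obtain V s where s: "strict_mono s" "(U \<circ> s) \<longlonglongrightarrow> V"
    using bounded_has_convergent_subsequence by blast
  have y: "(\<lambda>n. ?y (s n)) \<longlonglongrightarrow> x"
    using tendsto_diff[OF tendsto_const tendsto_of_real[OF LIMSEQ_subseq_LIMSEQ[OF \<open>r \<longlonglongrightarrow> 0\<close> s(1)]], of x]
    by (simp add: comp_def)
  have U: "(\<lambda>n. U (s n)) \<longlonglongrightarrow> V" using s(2) by (simp add: comp_def)
  have U1: "star (U n) * U n = 1" for n using Uh(1) by (simp add: unitary_def)
  have "(\<lambda>n. star (U (s n)) * U (s n)) \<longlonglongrightarrow> star V * V"
    by (intro tendsto_mult tendsto_star U)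
  then have V1: "star V * V = 1" unfolding U1 by (simp add: LIMSEQ_const_iff)
  then have V: "unitary star V" using left_inverse_commute by (simp add: unitary_def)
  let ?h = "star V * x"
  have hn: "h n = star (U n) * ?y n" for n
    unfolding Uh(2) by (simp add: mult.assoc[symmetric] U1)
  have h: "(\<lambda>n. h (s n)) \<longlonglongrightarrow> ?h"
    unfolding hn by (intro tendsto_mult tendsto_star U y)
  have "(\<lambda>n. star (h (s n))) \<longlonglongrightarrow> star ?h" by (rule tendsto_star[OF h])
  then have "star ?h = ?h" using h Uh(3) LIMSEQ_unique by (simp add: nonneg_def)
  moreover have "norm (of_real (norm ?h) - ?h) \<le> norm ?h"
  proof (rule LIMSEQ_le)
    show "(\<lambda>n. norm (of_real (norm (h (s n))) - h (s n))) \<longlonglongrightarrow> norm (of_real (norm ?h) - ?h)"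
      by (intro tendsto_intros h)
    show "(\<lambda>n. norm (h (s n))) \<longlonglongrightarrow> norm ?h" by (intro tendsto_intros h)
  qed (use Uh(3) nonneg_iff_norm in auto)
  ultimately have "nonneg ?h" by (auto simp: nonneg_def)
  moreover have "x = V * ?h" using V by (simp add: unitary_def mult.assoc[symmetric])
  ultimately show thesis using V that by blast
qed

end

section \<open>Birkhoff--James orthogonality\<close>

context cstar_algebra
begin

abbreviation orth :: "'a \<Rightarrow> 'a \<Rightarrow> bool" where
  "orth \<equiv> bj_orthogonal F smul"

lemma orthD: "orth v w \<Longrightarrow> c \<in> F \<Longrightarrow> norm v \<le> norm (v + smul c w)"
  by (simp add: bj_orthogonal_def)

lemma orth_scaleR: "orth v w \<Longrightarrow> norm v \<le> norm (v + r *\<^sub>R w)"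
  using orthD[of v w "of_real r"] by (simp add: smul_of_real)

lemma not_orthE:
  assumes "\<not> orth v w"
  obtains c where "c \<in> F" "norm (v + smul c w) < norm v"
  using assms by (auto simp: bj_orthogonal_def not_le)

lemma smul_inverse_cancel: "c \<in> F \<Longrightarrow> c \<noteq> 0 \<Longrightarrow> smul (inverse c) (smul c x) = x"
  by (subst smul_smul) (simp_all add: F_inverse)

lemma orth_smul_left_imp:
  assumes c: "c \<in> F" "c \<noteq> 0" and vw: "orth v w"
  shows "orth (smul c v) w"
  unfolding bj_orthogonal_def
proof
  fix d assume d: "d \<in> F"
  have F: "inverse c * d \<in> F" using c d by (simp add: F_mult F_inverse)
  have "smul c v + smul d w = smul c (v + smul (inverse c * d) w)"
    using c F by (simp add: smul_add_right smul_smul mult.assoc[symmetric])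
  then show "norm (smul c v) \<le> norm (smul c v + smul d w)"
    using orthD[OF vw F] c by (simp add: norm_smul mult_left_mono)
qed

lemma orth_smul_left:
  assumes "c \<in> F" "c \<noteq> 0"
  shows "orth (smul c v) w \<longleftrightarrow> orth v w"
proof
  assume "orth (smul c v) w"
  then have "orth (smul (inverse c) (smul c v)) w"
    using assms by (intro orth_smul_left_imp[of "inverse c" "smul c v"]) (simp_all add: F_inverse)
  then show "orth v w" by (simp only: smul_inverse_cancel[OF assms])
qed (rule orth_smul_left_imp[OF assms])

lemma orth_smul_right:
  assumes "c \<in> F" "orth v w"
  shows "orth v (smul c w)"
  using assms by (auto simp: bj_orthogonal_def smul_smul F_mult)

lemma orth_unitary_mult:
  assumes "unitary star u"
  shows "orth (u * v) (u * w) \<longleftrightarrow> orth v w"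
proof -
  have "norm (u * v + smul c (u * w)) = norm (v + smul c w)" if "c \<in> F" for c
    using norm_unitary_mult[OF assms, of "v + smul c w"] that
    by (simp add: distrib_left smul_mult_right)
  then show ?thesis by (simp add: bj_orthogonal_def norm_unitary_mult[OF assms])
qed

lemma unitary_star_cancel: "unitary star u \<Longrightarrow> u * (star u * x) = x"
  by (simp add: unitary_def mult.assoc[symmetric])

lemma perp_smul:
  assumes "c \<in> F" "c \<noteq> 0"
  shows "bj_perp F smul (smul c v) = bj_perp F smul v"
  by (simp add: bj_perp_def orth_smul_left[OF assms])

lemma perp_scaleR: "r \<noteq> 0 \<Longrightarrow> bj_perp F smul (r *\<^sub>R v) = bj_perp F smul v"
  using perp_smul[of "of_real r" v] by (simp add: smul_of_real)

end

context finite_dim_cstar_algebra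
begin

text \<open>
  Since the spectrum of \<open>h\<close> lies in \<open>[0, N]\<close> with \<open>N = norm h\<close>, its centre \<open>N / 2\<close> satisfies
  \<open>norm (h - N / 2) \<le> N / 2\<close>.  If adding \<open>c w\<close> decreases the norm of \<open>U\<close>, then it follows from
  \<open>U h + (N / 2) c w = U (h - N / 2) + (N / 2) (U + c w)\<close> that moving along \<open>w\<close> also decreases
  the norm of \<open>U h\<close>.
\<close>
lemma perp_subset_perp_polar_unitary:
  assumes U: "unitary star U" and h: "nonneg h" "h \<noteq> 0"
  shows "bj_perp F smul (U * h) \<subseteq> bj_perp F smul U"
proof
  fix w assume "w \<in> bj_perp F smul (U * h)"
  then have perp: "orth (U * h) w" by (simp add: bj_perp_def)
  show "w \<in> bj_perp F smul U"
  proof (rule ccontr)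
    assume "w \<notin> bj_perp F smul U"
    then obtain c where c: "c \<in> F" "norm (U + smul c w) < 1"
      using not_orthE[of U w] by (auto simp: bj_perp_def norm_unitary[OF U])
    define t where "t = norm h / 2"
    have t: "t > 0" using h by (simp add: t_def)
    obtain \<Lambda> e where sd: "spectral_decomposition h \<Lambda> e"
      using spectral_theorem h by (auto simp: nonneg_def)
    have centre: "norm (of_real t - h) \<le> t"
      unfolding spectral_shift[OF sd]
    proof (rule spectral_norm_le[OF sd])
      fix l assume l: "l \<in> \<Lambda>"
      then have "0 \<le> l" using h nonneg_iff_eigenvalues[OF sd] by blast
      then show "\<bar>t - l\<bar> \<le> t" using abs_eigenvalue_le[OF sd l] unfolding t_def by linarith
    qed
    have "U * h + smul (of_real t * c) w = t *\<^sub>R (U + smul c w) - U * (of_real t - h)"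
      using c by (simp add: scaleR_smul algebra_simps of_real_def)
    then have "norm (U * h + smul (of_real t * c) w)
        \<le> norm (t *\<^sub>R (U + smul c w)) + norm (U * (of_real t - h))"
      using norm_triangle_ineq4 by metis
    also have "\<dots> = t * norm (U + smul c w) + norm (of_real t - h)"
      using t by (simp add: norm_unitary_mult[OF U])
    also have "\<dots> < t * 1 + t"
      using c(2) t centre by (intro add_less_le_mono mult_strict_left_mono)
    also have "\<dots> = norm (U * h)" by (simp add: t_def norm_unitary_mult[OF U])
    finally show False
      using orthD[OF perp, of "of_real t * c"] c(1) by (simp add: F_mult)
  qed
qed

text \<open>
  Let \<open>e\<close> be the spectral projection of \<open>B\<^sup>* B\<close> for its largest eigenvalue.  Then \<open>B\<close> is never
  orthogonal to \<open>B e\<close>.  If there is another eigenvalue, then \<open>B e\<close> annihilates its spectral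
  projection, so every unitary is orthogonal to \<open>B e\<close>.
\<close>
lemma unitary_perp_subset_imp_unitary:
  assumes V: "unitary star V" and B: "B \<noteq> 0" and sub: "bj_perp F smul V \<subseteq> bj_perp F smul B"
  shows "\<exists>U. unitary star U \<and> B = norm B *\<^sub>R U"
proof -
  define N where "N = norm B"
  have N: "N > 0" using B by (simp add: N_def)
  obtain \<Lambda> e where sd: "spectral_decomposition (star B * B) \<Lambda> e" and nn: "\<And>l. l \<in> \<Lambda> \<Longrightarrow> 0 \<le> l"
    using spectral_decomposition_star_mult by blast
  have nT: "norm (star B * B) = N\<^sup>2" by (simp add: cstar_identity N_def)
  have top: "N\<^sup>2 \<in> \<Lambda>"
  proof -
    obtain k where "k \<in> \<Lambda>" "N\<^sup>2 = \<bar>k\<bar>"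
      using spectral_norm_attained[OF sd, of "\<lambda>l. l"] by (auto simp: spectral_id[OF sd] nT)
    then show ?thesis using nn[of k] by simp
  qed
  have "\<Lambda> = {N\<^sup>2}"
  proof (rule ccontr)
    assume "\<Lambda> \<noteq> {N\<^sup>2}"
    then obtain k where k: "k \<in> \<Lambda>" "k \<noteq> N\<^sup>2" using top by blast
    let ?e = "e (N\<^sup>2)"
    have ek: "?e * e k = 0" using sd k top by (auto simp: spectral_decomposition_def)
    have "orth V (B * ?e)"
      unfolding bj_orthogonal_def
    proof
      fix c assume c: "c \<in> F"
      have "(V + smul c (B * ?e)) * e k = V * e k"
        using c by (simp add: distrib_right smul_mult_left mult.assoc ek)
      then have "norm (V * e k) \<le> norm (V + smul c (B * ?e))"
        using norm_mult_projection_le[OF sd k(1)] by metis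
      then show "norm V \<le> norm (V + smul c (B * ?e))"
        using norm_unitary[OF V] norm_projection[OF sd k(1)] by (simp add: norm_unitary_mult[OF V])
    qed
    then have "orth B (B * ?e)" using sub by (auto simp: bj_perp_def)
    then have le: "N \<le> norm (B + (- (1 / 2)) *\<^sub>R (B * ?e))"
      unfolding N_def by (rule orth_scaleR)
    let ?f = "\<lambda>l. if l = N\<^sup>2 then 1 / 2 else 1 :: real"
    define g where "g = (\<Sum>l\<in>\<Lambda>. ?f l *\<^sub>R e l)"
    have fin: "finite \<Lambda>" using sd by (simp add: spectral_decomposition_def)
    have "g = (\<Sum>l\<in>\<Lambda>. e l - (if l = N\<^sup>2 then (1 / 2) *\<^sub>R e l else 0))"
      unfolding g_def by (intro sum.cong) (auto simp: scaleR_half_double[symmetric] algebra_simps simp flip: scaleR_add_left)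
    also have "\<dots> = 1 - (1 / 2) *\<^sub>R ?e"
      using top fin sd by (simp add: sum_subtractf spectral_decomposition_def)
    finally have "B + (- (1 / 2)) *\<^sub>R (B * ?e) = B * g" by (simp add: right_diff_distrib)
    with le have "N\<^sup>2 \<le> (norm (B * g))\<^sup>2" using N by (simp add: power_mono)
    also have "\<dots> = norm (star (B * g) * (B * g))" by (simp add: cstar_identity)
    also have "star (B * g) * (B * g) = g * ((star B * B) * g)"
      using spectral_star[OF sd, of ?f] by (simp add: star_mult mult.assoc g_def)
    also have "\<dots> = (\<Sum>l\<in>\<Lambda>. ?f l *\<^sub>R e l) * ((\<Sum>l\<in>\<Lambda>. l *\<^sub>R e l) * (\<Sum>l\<in>\<Lambda>. ?f l *\<^sub>R e l))"
      by (simp only: g_def spectral_id[OF sd])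
    also have "\<dots> = (\<Sum>l\<in>\<Lambda>. (?f l * (l * ?f l)) *\<^sub>R e l)"
      by (simp only: spectral_mult[OF sd])
    finally have "N\<^sup>2 \<le> norm (\<Sum>l\<in>\<Lambda>. (?f l * (l * ?f l)) *\<^sub>R e l)" .
    then obtain j where j: "j \<in> \<Lambda>" "N\<^sup>2 \<le> \<bar>?f j * (j * ?f j)\<bar>"
      using spectral_norm_attained[OF sd, of "\<lambda>l. ?f l * (l * ?f l)"] by auto
    have "j \<le> N\<^sup>2" using abs_eigenvalue_le[OF sd j(1)] nT by simp
    moreover have "N\<^sup>2 > 0" using N by simp
    ultimately show False using j(2) nn[OF j(1)] by (auto split: if_splits)
  qed
  then have "star B * B = of_real (N\<^sup>2)"
    using spectral_id[OF sd] spectral_const[OF sd, of "N\<^sup>2"] by simp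
  then have u: "star ((1 / N) *\<^sub>R B) * ((1 / N) *\<^sub>R B) = 1"
    using N by (simp add: star_scaleR of_real_def power2_eq_square)
  then have "unitary star ((1 / N) *\<^sub>R B)" using left_inverse_commute[OF u] by (simp add: unitary_def)
  moreover have "B = norm B *\<^sub>R ((1 / N) *\<^sub>R B)" using N by (simp add: N_def)
  ultimately show ?thesis by blast
qed

text \<open>
  Two powers of \<open>u\<close> come close to each other by compactness; dividing by the smaller one is an
  isometry.
\<close>
lemma unitary_recurrence:
  assumes u: "unitary star u" and "\<epsilon> > 0"
  obtains n where "norm (1 - u ^ Suc n) < \<epsilon>"
proof -
  have pow: "unitary star (u ^ n)" for n
    by (induction n) (simp_all add: unitary_1 unitary_mult u)
  have "bounded (range (\<lambda>n. u ^ n))" using norm_unitary[OF pow] by (auto simp: bounded_iff)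
  then obtain l s where s: "strict_mono s" "((\<lambda>n. u ^ n) \<circ> s) \<longlonglongrightarrow> l"
    using bounded_has_convergent_subsequence by blast
  then have "Cauchy ((\<lambda>n. u ^ n) \<circ> s)" by (intro LIMSEQ_imp_Cauchy)
  then obtain M where M: "\<And>i j. i \<ge> M \<Longrightarrow> j \<ge> M \<Longrightarrow> norm (u ^ s i - u ^ s j) < \<epsilon>"
    using \<open>\<epsilon> > 0\<close> by (simp add: Cauchy_iff) blast
  have "s M < s (Suc M)" using s(1) by (simp add: strict_mono_def)
  then obtain n where n: "s (Suc M) = s M + Suc n" using less_imp_Suc_add by auto
  have "u ^ s M - u ^ s (Suc M) = u ^ s M * (1 - u ^ Suc n)"
    unfolding n power_add by (simp only: right_diff_distrib mult_1_right)
  then have "norm (1 - u ^ Suc n) = norm (u ^ s M - u ^ s (Suc M))"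
    using norm_unitary_mult[OF pow] by metis
  then show thesis using that[of n] M[of M "Suc M"] by simp
qed

text \<open>
  Write \<open>B = W V\<close> with \<open>W\<close> unitary.  The inclusion says that the orthogonal set of \<open>V\<close> is stable
  under \<open>W\<^sup>*\<close>, and \<open>W\<^sup>*\<close> maps that of \<open>B\<close> into it.  As positive powers of \<open>W\<^sup>*\<close> come arbitrarily
  close to the identity and orthogonality to a fixed vector is a closed condition, the orthogonal
  set of \<open>B\<close> is itself contained in that of \<open>V\<close>.
\<close>
lemma unitary_perp_subset_imp_supset:
  assumes V: "unitary star V" and B: "unitary star B"
    and sub: "bj_perp F smul V \<subseteq> bj_perp F smul B"
  shows "bj_perp F smul B \<subseteq> bj_perp F smul V"
proof
  fix y assume "y \<in> bj_perp F smul B"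
  then have y: "orth B y" by (simp add: bj_perp_def)
  define W where "W = B * star V"
  have W: "unitary star W" unfolding W_def by (intro unitary_mult unitary_star V B)
  have WV: "W * V = B" using V by (simp add: W_def mult.assoc unitary_def)
  have pull: "orth V (star W * x)" if "orth B x" for x
  proof -
    have "orth (W * V) (W * (star W * x))" using that by (simp add: WV unitary_star_cancel[OF W])
    then show ?thesis by (simp only: orth_unitary_mult[OF W])
  qed
  have powers: "orth V (star W ^ Suc n * y)" for n
  proof (induction n)
    case 0
    show ?case using pull[OF y] by simp
  next
    case (Suc n)
    then have "orth B (star W ^ Suc n * y)" using sub by (auto simp: bj_perp_def)
    from pull[OF this] show ?case by (simp add: mult.assoc)
  qed
  show "y \<in> bj_perp F smul V"
  proof (rule ccontr)
    assume "y \<notin> bj_perp F smul V"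
    then obtain c where c: "c \<in> F" "norm (V + smul c y) < norm V"
      using not_orthE[of V y] by (auto simp: bj_perp_def)
    define \<epsilon> where "\<epsilon> = (norm V - norm (V + smul c y)) / (norm (smul c y) + 1)"
    have "\<epsilon> > 0" using c(2) by (simp add: \<epsilon>_def divide_pos_pos add_nonneg_pos)
    then obtain n where n: "norm (1 - star W ^ Suc n) < \<epsilon>"
      using unitary_recurrence[OF unitary_star[OF W]] by blast
    let ?P = "star W ^ Suc n"
    have "V + smul c (?P * y) = (V + smul c y) - (1 - ?P) * smul c y"
      using c by (simp add: smul_mult_right algebra_simps)
    then have "norm (V + smul c (?P * y)) \<le> norm (V + smul c y) + norm ((1 - ?P) * smul c y)"
      using norm_triangle_ineq4 by metis
    also have "norm ((1 - ?P) * smul c y) \<le> norm (1 - ?P) * norm (smul c y)" by (rule norm_mult_ineq)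
    also have "\<dots> \<le> \<epsilon> * norm (smul c y)" using n by (intro mult_right_mono) auto
    also have "\<dots> < \<epsilon> * (norm (smul c y) + 1)" using \<open>\<epsilon> > 0\<close> by simp
    also have "\<dots> = norm V - norm (V + smul c y)"
      unfolding \<epsilon>_def using add_nonneg_pos[OF norm_ge_zero zero_less_one, of "smul c y"] by simp
    finally show False using orthD[OF powers c(1), of n] by simp
  qed
qed

text \<open>
  With \<open>N = norm x\<close> and \<open>d = norm (1 - x) < 1\<close>, the identity
  \<open>(x - t)\<^sup>* (x - t) + t = (1 - t) x\<^sup>* x + t (1 - x)\<^sup>* (1 - x) + t\<^sup>2\<close> bounds the norm of its left-hand
  side by \<open>(1 - t) N\<^sup>2 + t d\<^sup>2 + t\<^sup>2\<close>; by positivity that norm is at least \<open>norm (x - t)\<^sup>2 + t\<close>.  The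
  choice \<open>t = (1 - d\<^sup>2) / 2\<close> makes \<open>norm (x - t) < N\<close>.
\<close>
lemma near_one_not_orth_one:
  assumes "norm (1 - x) < 1"
  shows "\<not> orth x 1"
proof
  assume orth: "orth x 1"
  define N where "N = norm x"
  define d where "d = norm (1 - x)"
  define t where "t = (1 - d\<^sup>2) / 2"
  have d: "0 \<le> d" "d\<^sup>2 < 1" using assms by (auto simp: d_def power_less_one_iff)
  have t: "0 < t" "t < 1" "d\<^sup>2 + t < 1"
    using d add_pos_nonneg[OF zero_less_one zero_le_power2[of d]] by (simp_all add: t_def field_simps)
  let ?y = "x - of_real t"
  have expand: "star ?y * ?y + of_real t
      = (1 - t) *\<^sub>R (star x * x) + t *\<^sub>R (star (1 - x) * (1 - x)) + of_real (t\<^sup>2)"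
    by (simp add: star_diff star_scaleR of_real_def algebra_simps power2_eq_square)
  have "(norm ?y)\<^sup>2 + t \<le> norm (star ?y * ?y + of_real t)"
    using t by (intro norm_star_mult_add_ge) simp
  also have "\<dots> \<le> norm ((1 - t) *\<^sub>R (star x * x)) + norm (t *\<^sub>R (star (1 - x) * (1 - x)))
      + norm (of_real (t\<^sup>2) :: 'a)"
    unfolding expand by (intro norm_triangle_mono norm_triangle_ineq order_refl)
  also have "\<dots> = (1 - t) * N\<^sup>2 + t * d\<^sup>2 + t\<^sup>2"
    using t unfolding norm_scaleR cstar_identity norm_of_real by (simp add: N_def d_def)
  finally have "(norm ?y)\<^sup>2 \<le> N\<^sup>2 + t * (d\<^sup>2 + t - 1 - N\<^sup>2)"
    by (simp add: algebra_simps power2_eq_square)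
  also have "\<dots> < N\<^sup>2"
  proof -
    have "d\<^sup>2 + t - 1 - N\<^sup>2 < 0" using t(3) zero_le_power2[of N] by linarith
    then show ?thesis using mult_pos_neg[OF t(1)] by simp
  qed
  finally have "norm ?y < N" unfolding N_def by (rule power_less_imp_less_base) simp
  moreover have "N \<le> norm ?y"
    using orth_scaleR[OF orth, of "- t"] by (simp add: N_def of_real_def)
  ultimately show False by simp
qed

lemma unitary_right_symmetric:
  assumes V: "unitary star V"
  shows "right_symmetric F smul V"
  unfolding right_symmetric_def
proof (intro allI impI)
  fix w assume w: "orth w V"
  show "orth V w"
  proof (rule ccontr)
    assume "\<not> orth V w"
    then obtain c where c: "c \<in> F" "norm (V + smul c w) < 1"
      using not_orthE[of V w] by (auto simp: norm_unitary[OF V])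
    have "c \<noteq> 0" using c(2) norm_unitary[OF V] by auto
    have mc: "- c \<in> F" using c(1) F_mult[of "-1" c] by simp
    let ?x = "star V * smul (- c) w"
    have "orth (smul (- c) w) V" using w mc \<open>c \<noteq> 0\<close> by (simp add: orth_smul_left)
    then have "orth (V * ?x) (V * 1)" by (simp add: unitary_star_cancel[OF V])
    then have "orth ?x 1" by (simp only: orth_unitary_mult[OF V])
    moreover have "V * (1 - ?x) = V + smul c w"
      using c(1) unfolding right_diff_distrib unitary_star_cancel[OF V] by (simp add: smul_minus_left)
    then have "norm (1 - ?x) < 1" using c(2) norm_unitary_mult[OF V, of "1 - ?x"] by simp
    ultimately show False using near_one_not_orth_one by blast
  qed
qed

text \<open>
  In the polar form \<open>A = U h\<close>, let \<open>s\<close> be the reflection that is \<open>1\<close> on the top eigenspace of \<open>h\<close>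
  and \<open>- 1\<close> on the others.  Whatever \<open>c\<close> is, \<open>s + c h\<close> has norm at least \<open>1\<close>, on the top eigenspace
  if \<open>Re c \<ge> 0\<close> and on any other one if not, so \<open>s\<close> is orthogonal to \<open>h\<close>.  But \<open>h - t s\<close> is smaller
  than \<open>h\<close> for small \<open>t > 0\<close>.
\<close>
lemma right_symmetric_imp_unitary:
  assumes rs: "right_symmetric F smul A" and A: "A \<noteq> 0"
  shows "\<exists>U. unitary star U \<and> A = norm A *\<^sub>R U"
proof -
  obtain U h where U: "unitary star U" and Uh: "A = U * h" and h: "nonneg h"
    using polar_decomposition .
  define N where "N = norm h"
  have NA: "norm A = N" unfolding Uh N_def by (rule norm_unitary_mult[OF U])
  have N: "N > 0" using A NA by auto
  obtain \<Lambda> e where sd: "spectral_decomposition h \<Lambda> e"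
    using spectral_theorem h by (auto simp: nonneg_def)
  have nn: "0 \<le> l" if "l \<in> \<Lambda>" for l using that h nonneg_iff_eigenvalues[OF sd] by blast
  have le: "l \<le> N" if "l \<in> \<Lambda>" for l
    using abs_eigenvalue_le[OF sd that] by (simp add: N_def)
  have top: "N \<in> \<Lambda>"
  proof -
    obtain k where "k \<in> \<Lambda>" "N = \<bar>k\<bar>"
      using spectral_norm_attained[OF sd, of "\<lambda>l. l"] by (auto simp: spectral_id[OF sd] N_def)
    then show ?thesis using nn[of k] by simp
  qed
  have fin: "finite \<Lambda>" using sd by (simp add: spectral_decomposition_def)
  have "\<Lambda> = {N}"
  proof (rule ccontr)
    assume "\<Lambda> \<noteq> {N}"
    then have ne: "\<Lambda> - {N} \<noteq> {}" using top by blast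
    define m where "m = Max (\<Lambda> - {N})"
    have m: "m \<in> \<Lambda>" "m \<noteq> N" using Max_in[of "\<Lambda> - {N}"] fin ne by (auto simp: m_def)
    then have mN: "0 \<le> m" "m < N" using nn le by (auto simp: less_le)
    have m_max: "l \<le> m" if "l \<in> \<Lambda>" "l \<noteq> N" for l using that fin by (simp add: m_def)
    let ?f = "\<lambda>l. if l = N then 1 else - 1 :: real"
    define s where "s = (\<Sum>l\<in>\<Lambda>. ?f l *\<^sub>R e l)"
    have "norm s \<le> 1" unfolding s_def by (intro spectral_norm_le[OF sd]) simp
    have block: "cmod (of_real (?f k) + c * of_real k) \<le> norm (s + smul c h)"
      if c: "c \<in> F" and k: "k \<in> \<Lambda>" for c k
    proof -
      have "(s + smul c h) * e k = ?f k *\<^sub>R e k + smul c (k *\<^sub>R e k)"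
        using c spectral_mult_left[OF sd k, of ?f] spectral_eigen[OF sd k]
        by (simp only: distrib_right smul_mult_left s_def)
      also have "\<dots> = smul (of_real (?f k)) (e k) + smul (c * of_real k) (e k)"
        using c by (simp only: smul_of_real smul_scaleR)
      also have "\<dots> = smul (of_real (?f k) + c * of_real k) (e k)"
        using c by (subst smul_add_left) (simp_all add: F_mult)
      finally have "norm ((s + smul c h) * e k) = cmod (of_real (?f k) + c * of_real k)"
        using c by (subst (asm) eq_commute) (metis F_add F_mult mult_1_right norm_projection[OF sd k] norm_smul of_real_in_F)
      then show ?thesis using norm_mult_projection_le[OF sd k] by metis
    qed
    have "orth s h"
      unfolding bj_orthogonal_def
    proof
      fix c assume c: "c \<in> F"
      have "1 \<le> norm (s + smul c h)"
      proof (cases "0 \<le> Re c")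
        case True
        have "1 \<le> Re (1 + c * of_real N)" using True N by simp
        then show ?thesis
          using block[OF c top] complex_Re_le_cmod[of "1 + c * of_real N"] by simp
      next
        case False
        have "Re c * m \<le> 0" using False mN by (intro mult_nonpos_nonneg) auto
        then have "1 \<le> \<bar>Re (- 1 + c * of_real m)\<bar>" by simp
        then show ?thesis
          using block[OF c m(1)] m(2) abs_Re_le_cmod[of "- 1 + c * of_real m"] by simp
      qed
      then show "norm s \<le> norm (s + smul c h)" using \<open>norm s \<le> 1\<close> by simp
    qed
    then have "orth (U * s) A" unfolding Uh by (simp only: orth_unitary_mult[OF U])
    then have "orth (U * h) (U * s)" using rs unfolding right_symmetric_def Uh by blast
    then have hs: "orth h s" by (simp only: orth_unitary_mult[OF U])
    define t where "t = (N - m) / 2"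
    have "h + (- t) *\<^sub>R s = (\<Sum>l\<in>\<Lambda>. l *\<^sub>R e l) + (\<Sum>l\<in>\<Lambda>. (- t * ?f l) *\<^sub>R e l)"
      unfolding s_def spectral_id[OF sd] by (simp only: scaleR_sum_right scaleR_scaleR)
    also have "\<dots> = (\<Sum>l\<in>\<Lambda>. (l + - t * ?f l) *\<^sub>R e l)"
      by (simp only: scaleR_add_left sum.distrib)
    finally have "h + (- t) *\<^sub>R s = (\<Sum>l\<in>\<Lambda>. (l + - t * ?f l) *\<^sub>R e l)" .
    then obtain k where k: "k \<in> \<Lambda>" "norm (h + (- t) *\<^sub>R s) = \<bar>k + - t * ?f k\<bar>"
      using spectral_norm_attained[OF sd, of "\<lambda>l. l + - t * ?f l"] by auto
    have "\<bar>k + - t * ?f k\<bar> < N"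
    proof (cases "k = N")
      case True
      then show ?thesis using mN by (simp add: t_def)
    next
      case False
      then show ?thesis using mN m_max[OF k(1) False] nn[OF k(1)] unfolding t_def by (simp add: field_simps)
    qed
    then show False using orth_scaleR[OF hs, of "- t"] k(2) by (simp add: N_def)
  qed
  then have "h = of_real N" using spectral_id[OF sd] spectral_const[OF sd, of N] by simp
  then have "A = norm A *\<^sub>R U" unfolding NA unfolding Uh by (simp add: of_real_def)
  then show ?thesis using U by blast
qed

lemma perp_maximal_imp_unitary:
  assumes A: "A \<noteq> 0" and max: "\<not> (\<exists>B. B \<noteq> 0 \<and> bj_perp F smul A \<subset> bj_perp F smul B)"
  shows "\<exists>U. unitary star U \<and> A = norm A *\<^sub>R U"
proof -
  obtain U h where U: "unitary star U" and Uh: "A = U * h" and h: "nonneg h"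
    using polar_decomposition .
  have "bj_perp F smul A \<subseteq> bj_perp F smul U"
    unfolding Uh using A Uh by (intro perp_subset_perp_polar_unitary U h) auto
  moreover have "U \<noteq> 0" using norm_unitary[OF U] by auto
  ultimately have "bj_perp F smul U \<subseteq> bj_perp F smul A" using max by blast
  then show ?thesis by (rule unitary_perp_subset_imp_unitary[OF U A])
qed

lemma unitary_perp_maximal:
  assumes U: "unitary star U"
  shows "\<not> (\<exists>B. B \<noteq> 0 \<and> bj_perp F smul U \<subset> bj_perp F smul B)"
proof
  assume "\<exists>B. B \<noteq> 0 \<and> bj_perp F smul U \<subset> bj_perp F smul B"
  then obtain B where B: "B \<noteq> 0" "bj_perp F smul U \<subset> bj_perp F smul B" by blast
  then obtain V where V: "unitary star V" "B = norm B *\<^sub>R V"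
    using unitary_perp_subset_imp_unitary[OF U] by blast
  then have "bj_perp F smul B = bj_perp F smul V" using B(1) perp_scaleR[of "norm B" V] by simp
  then show False using unitary_perp_subset_imp_supset[OF U V(1)] B(2) by blast
qed

lemma right_symmetric_smul:
  assumes c: "c \<in> F" "c \<noteq> 0" and v: "right_symmetric F smul v"
  shows "right_symmetric F smul (smul c v)"
  unfolding right_symmetric_def
proof (intro allI impI)
  fix w assume "orth w (smul c v)"
  then have "orth w (smul (inverse c) (smul c v))"
    using c by (intro orth_smul_right[of "inverse c" w "smul c v"]) (simp_all add: F_inverse)
  then have "orth w v" by (simp only: smul_inverse_cancel[OF c])
  then show "orth (smul c v) w" using v c by (simp add: orth_smul_left right_symmetric_def)
qed

end

theorem lemma2p4:
  fixes F :: "complex set"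
    and smul :: "complex \<Rightarrow> 'a \<Rightarrow> 'a::{real_normed_algebra_1, banach}"
    and star :: "'a \<Rightarrow> 'a"
    and A :: 'a
  assumes "finite_dim_cstar_algebra F smul star"
  shows "((\<exists>c\<in>F. \<exists>U. unitary star U \<and> A = smul c U) \<longleftrightarrow>
            \<not> (\<exists>B. B \<noteq> 0 \<and> bj_perp F smul A \<subset> bj_perp F smul B)) \<and>
         (\<not> (\<exists>B. B \<noteq> 0 \<and> bj_perp F smul A \<subset> bj_perp F smul B) \<longleftrightarrow>
            right_symmetric F smul A)"
proof -
  interpret finite_dim_cstar_algebra F smul star by (rule assms)
  show ?thesis
  proof (cases "A = 0")
    case True
    have "A = smul 0 1" using True by simp
    then have "\<exists>c\<in>F. \<exists>U. unitary star U \<and> A = smul c U"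
      using unitary_1 zero_in_F by blast
    moreover have "bj_perp F smul A = UNIV"
      using True by (simp add: bj_perp_def bj_orthogonal_def)
    moreover have "right_symmetric F smul A"
      using True by (simp add: right_symmetric_def bj_orthogonal_def)
    ultimately show ?thesis by auto
  next
    case False
    let ?i = "\<exists>c\<in>F. \<exists>U. unitary star U \<and> A = smul c U"
    let ?ii = "\<not> (\<exists>B. B \<noteq> 0 \<and> bj_perp F smul A \<subset> bj_perp F smul B)"
    have norm_multiple: ?i if "\<exists>U. unitary star U \<and> A = norm A *\<^sub>R U"
      using that smul_of_real of_real_in_F by metis
    have "?ii \<and> right_symmetric F smul A" if ?i
    proof -
      obtain c U where c: "c \<in> F" and U: "unitary star U" "A = smul c U" using \<open>?i\<close> by blast
      have "c \<noteq> 0" using False U(2) by auto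
      then show ?thesis
        using unitary_perp_maximal[OF U(1)] right_symmetric_smul[OF c _ unitary_right_symmetric[OF U(1)]]
        by (simp add: U(2) perp_smul[OF c])
    qed
    then show ?thesis
      using norm_multiple perp_maximal_imp_unitary[OF False] right_symmetric_imp_unitary[OF _ False]
      by blast
  qed
qed

end
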